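(* For every real number $\alpha$ with $0<\alpha<1/2$, the group $N_4$ of $4\times 4$ lower triangular matrices with integer entries and $1$'s on the diagonal embeds into $\mathrm{Diff}_+^{1+\alpha}([0,1])$; that is, there exists an injective group homomorphism $N_4\to \mathrm{Diff}_+^{1+\alpha}([0,1])$.
   Context: $\mathrm{Diff}_+^{1+\alpha}([0,1])$ is the group (under composition) of orientation-preserving $C^1$ diffeomorphisms $f$ of $[0,1]$ of class $C^{1+\alpha}$, meaning that the derivative is $\alpha$-Hölder continuous: there exists $C>0$ such that $|f'(x)-f'(y)|\le C|x-y|^\alpha$ for all $x,y\in[0,1]$. *)

theory Defs
  imports "HOL-Analysis.Analysis" "HOL-Algebra.Bij" "Jordan_Normal_Form.Matrix"
begin

section \<open>Integer unitriangular matrices\<close>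

definition lower_unitriangular_mats :: "nat \<Rightarrow> int mat set" where
  "lower_unitriangular_mats n =
     {A \<in> carrier_mat n n. (\<forall>i<n. \<forall>j<n. i < j \<longrightarrow> A $$ (i, j) = 0) \<and> (\<forall>i<n. A $$ (i, i) = 1)}"

definition unitriangular_group :: "nat \<Rightarrow> int mat monoid" where
  "unitriangular_group n =
     \<lparr>carrier = lower_unitriangular_mats n, monoid.mult = (*), one = 1\<^sub>m n\<rparr>"


section \<open>Diffeomorphisms of the unit interval\<close>

text \<open>Derivatives are taken within the set, so they are one-sided at the endpoints of an interval.
  On a nondegenerate interval they are unique, so the existential quantifiers over
  derivatives below are harmless.\<close>

definition C1_on :: "real set \<Rightarrow> (real \<Rightarrow> real) \<Rightarrow> bool" where
  "C1_on S f \<longleftrightarrow> (\<exists>f'. (\<forall>x\<in>S. (f has_real_derivative f' x) (at x within S)) \<and> continuous_on S f')"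

definition Holder_on :: "real \<Rightarrow> real set \<Rightarrow> (real \<Rightarrow> real) \<Rightarrow> bool" where
  "Holder_on \<alpha> S g \<longleftrightarrow> (\<exists>C>0. \<forall>x\<in>S. \<forall>y\<in>S. \<bar>g x - g y\<bar> \<le> C * \<bar>x - y\<bar> powr \<alpha>)"

definition Holder_deriv_on :: "real \<Rightarrow> real set \<Rightarrow> (real \<Rightarrow> real) \<Rightarrow> bool" where
  "Holder_deriv_on \<alpha> S f \<longleftrightarrow>
     (\<exists>f'. (\<forall>x\<in>S. (f has_real_derivative f' x) (at x within S)) \<and> Holder_on \<alpha> S f')"

text \<open>As in \<^const>\<open>BijGroup\<close>, a self-map of the interval is represented by its extensional version
  (constantly \<^const>\<open>undefined\<close> outside the interval), so that equality of representatives is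
  equality of maps on the interval.\<close>

definition diffeos :: "real \<Rightarrow> (real \<Rightarrow> real) set" where
  "diffeos \<alpha> = {f \<in> Bij {0..1}. strict_mono_on {0..1} f \<and>
     C1_on {0..1} f \<and> C1_on {0..1} (inv_into {0..1} f) \<and> Holder_deriv_on \<alpha> {0..1} f}"

definition Diff_group :: "real \<Rightarrow> (real \<Rightarrow> real) monoid" where
  "Diff_group \<alpha> = BijGroup {0..1} \<lparr>carrier := diffeos \<alpha>\<rparr>"


section \<open>Both structures are groups\<close>

lemma unitriangular_mult:
  assumes A: "A \<in> lower_unitriangular_mats n" and B: "B \<in> lower_unitriangular_mats n"
  shows "A * B \<in> lower_unitriangular_mats n"
proof -
  have c: "A \<in> carrier_mat n n" "B \<in> carrier_mat n n"
    using A B by (auto simp: lower_unitriangular_mats_def)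
  have e: "(A * B) $$ (i, j) = (\<Sum>k<n. A $$ (i, k) * B $$ (k, j))" if "i < n" "j < n" for i j
    using that c by (simp add: scalar_prod_def atLeast0LessThan)
  have z: "(A * B) $$ (i, j) = 0" if "i < n" "j < n" "i < j" for i j
  proof -
    have "A $$ (i, k) * B $$ (k, j) = 0" if "k < n" for k
      using that \<open>i < n\<close> \<open>j < n\<close> \<open>i < j\<close> A B
      by (cases "i < k") (auto simp: lower_unitriangular_mats_def)
    then show ?thesis using e[OF that(1,2)] by (metis (no_types, lifting) lessThan_iff sum.neutral)
  qed
  have d: "(A * B) $$ (i, i) = 1" if "i < n" for i
  proof -
    have "A $$ (i, k) * B $$ (k, i) = (if k = i then 1 else 0)" if "k < n" for k
      using that \<open>i < n\<close> A B
      by (cases k i rule: linorder_cases) (auto simp: lower_unitriangular_mats_def)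
    then have "(\<Sum>k<n. A $$ (i, k) * B $$ (k, i)) = (\<Sum>k<n. if k = i then 1 else 0)"
      by (intro sum.cong) auto
    then show ?thesis using e[OF that that] that by simp
  qed
  show ?thesis using z d c by (auto simp: lower_unitriangular_mats_def)
qed

lemma unitriangular_left_inverse:
  assumes A: "A \<in> lower_unitriangular_mats 4"
  shows "\<exists>B\<in>lower_unitriangular_mats 4. B * A = 1\<^sub>m 4"
proof -
  define a b c d e f where abc: "a = A $$ (1,0)" "b = A $$ (2,0)" "c = A $$ (2,1)"
    "d = A $$ (3,0)" "e = A $$ (3,1)" "f = A $$ (3,2)"
  define B :: "int mat" where "B = mat 4 4 (\<lambda>(i, j).
     if i = j then 1 else if i = 1 \<and> j = 0 then - a
     else if i = 2 \<and> j = 0 then a * c - b else if i = 2 \<and> j = 1 then - c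
     else if i = 3 \<and> j = 0 then - d + a * e + b * f - a * c * f
     else if i = 3 \<and> j = 1 then c * f - e else if i = 3 \<and> j = 2 then - f else 0)"
  have lt4: "i < 4 \<longleftrightarrow> i = 0 \<or> i = 1 \<or> i = 2 \<or> i = 3" for i :: nat by auto
  have "B \<in> lower_unitriangular_mats 4"
    by (auto simp: lower_unitriangular_mats_def B_def)
  moreover have "B * A = 1\<^sub>m 4"
  proof (rule eq_matI)
    fix i j assume "i < dim_row (1\<^sub>m 4 :: int mat)" "j < dim_col (1\<^sub>m 4 :: int mat)"
    then have ij: "i < 4" "j < 4" by auto
    have cA: "A \<in> carrier_mat 4 4" using A by (auto simp: lower_unitriangular_mats_def)
    have zA: "A $$ (k, l) = 0" if "k < l" "l < 4" for k l
      using that A by (auto simp: lower_unitriangular_mats_def)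
    have zA': "A $$ (0,1) = 0" "A $$ (0,2) = 0" "A $$ (0,3) = 0" "A $$ (1,2) = 0"
      "A $$ (1,3) = 0" "A $$ (2,3) = 0" by (auto intro!: zA)
    have oA: "A $$ (0,0) = 1" "A $$ (1,1) = 1" "A $$ (2,2) = 1" "A $$ (3,3) = 1"
      using A by (auto simp: lower_unitriangular_mats_def)
    have "(B * A) $$ (i, j) = (\<Sum>k\<in>{0,1,2,3}. B $$ (i, k) * A $$ (k, j))"
    proof -
      have "{0..<4} = {0,1,2,3::nat}" by auto
      then show ?thesis using ij cA by (simp add: scalar_prod_def B_def)
    qed
    also have "\<dots> = (if i = j then 1 else 0)"
      using ij unfolding lt4
      by (elim disjE) (simp_all add: B_def zA'[unfolded One_nat_def] oA[unfolded One_nat_def]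
          abc[unfolded One_nat_def, symmetric] algebra_simps)
    finally show "(B * A) $$ (i, j) = 1\<^sub>m 4 $$ (i, j)" using ij by simp
  qed (use A in \<open>auto simp: B_def lower_unitriangular_mats_def\<close>)
  ultimately show ?thesis by blast
qed

lemma group_unitriangular_group: "group (unitriangular_group 4)"
proof (rule groupI)
  fix x y z assume "x \<in> carrier (unitriangular_group 4)" "y \<in> carrier (unitriangular_group 4)"
    "z \<in> carrier (unitriangular_group 4)"
  then have "x \<in> carrier_mat 4 4" "y \<in> carrier_mat 4 4" "z \<in> carrier_mat 4 4"
    by (auto simp: unitriangular_group_def lower_unitriangular_mats_def)
  then show "x \<otimes>\<^bsub>unitriangular_group 4\<^esub> y \<otimes>\<^bsub>unitriangular_group 4\<^esub> z
    = x \<otimes>\<^bsub>unitriangular_group 4\<^esub> (y \<otimes>\<^bsub>unitriangular_group 4\<^esub> z)"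
    by (simp add: unitriangular_group_def)
qed (auto simp: unitriangular_group_def unitriangular_mult unitriangular_left_inverse,
     auto simp: lower_unitriangular_mats_def)

lemma has_real_derivative_transform_on:
  assumes "x \<in> S" "\<And>y. y \<in> S \<Longrightarrow> h y = f y" "(f has_real_derivative D) (at x within S)"
  shows "(h has_real_derivative D) (at x within S)"
  using has_derivative_transform[OF assms(1,2)] assms(3) by (auto simp: has_field_derivative_def)

lemma deriv_unique_01:
  assumes "(f has_real_derivative a) (at x within {0..1})"
    "(f has_real_derivative b) (at x within {0..1})" "x \<in> {0..1::real}"
  shows "a = b"
proof -
  have "at x within {0..1} \<noteq> bot"
    using assms(3) by (simp add: trivial_limit_within islimpt_Icc)
  with assms(1,2) show ?thesis
    by (auto simp: has_field_derivative_iff intro: tendsto_unique)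
qed

lemma C1_on_compose:
  assumes f: "C1_on S f" and g: "C1_on S g" and gS: "g ` S \<subseteq> S"
    and h: "\<And>x. x \<in> S \<Longrightarrow> h x = f (g x)"
  shows "C1_on S h"
proof -
  obtain f' where f': "\<And>x. x \<in> S \<Longrightarrow> (f has_real_derivative f' x) (at x within S)"
    "continuous_on S f'" using f by (auto simp: C1_on_def)
  obtain g' where g': "\<And>x. x \<in> S \<Longrightarrow> (g has_real_derivative g' x) (at x within S)"
    "continuous_on S g'" using g by (auto simp: C1_on_def)
  have "(h has_real_derivative f' (g x) * g' x) (at x within S)" if x: "x \<in> S" for x
  proof -
    have "(f has_real_derivative f' (g x)) (at (g x) within g ` S)"
      using f'(1) gS x by (blast intro: DERIV_subset)
    then have "(f \<circ> g has_real_derivative f' (g x) * g' x) (at x within S)"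
      using DERIV_image_chain g'(1)[OF x] by blast
    then show ?thesis
      by (rule has_real_derivative_transform_on[OF x, rotated]) (simp add: h)
  qed
  moreover have "continuous_on S g"
    using g'(1) by (auto intro: DERIV_continuous_on)
  then have "continuous_on S (\<lambda>x. f' (g x) * g' x)"
    by (rule continuous_on_mult[OF continuous_on_compose2[OF f'(2) _ gS] g'(2)])
  ultimately show ?thesis
    unfolding C1_on_def by (intro exI[of _ "\<lambda>x. f' (g x) * g' x"] conjI ballI)
qed

lemma C1_on_cong:
  assumes "C1_on S f" "\<And>x. x \<in> S \<Longrightarrow> h x = f x"
  shows "C1_on S h"
proof (rule C1_on_compose[OF assms(1)])
  show "C1_on S (\<lambda>x. x)"
    unfolding C1_on_def by (intro exI[of _ "\<lambda>_. 1"] conjI ballI DERIV_ident continuous_on_const)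
qed (simp_all add: assms(2))

lemma C1_on_01_bounds:
  assumes "C1_on {0..1} g"
  obtains g' M where "\<And>x. x \<in> {0..1} \<Longrightarrow> (g has_real_derivative g' x) (at x within {0..1})"
    "M > 0" "\<And>x. x \<in> {0..1} \<Longrightarrow> \<bar>g' x\<bar> \<le> M"
    "\<And>x y. x \<in> {0..1} \<Longrightarrow> y \<in> {0..1} \<Longrightarrow> \<bar>g x - g y\<bar> \<le> M * \<bar>x - y\<bar>"
proof -
  obtain g' where g': "\<And>x. x \<in> {0..1} \<Longrightarrow> (g has_real_derivative g' x) (at x within {0..1})"
    "continuous_on {0..1} g'" using assms unfolding C1_on_def by blast
  have "bounded (g' ` {0..1})"
    using g'(2) compact_Icc by (intro compact_imp_bounded compact_continuous_image)
  then obtain M where M: "M > 0" "\<And>x. x \<in> {0..1} \<Longrightarrow> \<bar>g' x\<bar> \<le> M"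
    by (auto simp: bounded_pos)
  have "\<bar>g x - g y\<bar> \<le> M * \<bar>x - y\<bar>" if "x \<in> {0..1}" "y \<in> {0..1}" for x y
    using field_differentiable_bound[of "{0..1}" g g' M x y] that g'(1) M(2)
    by (auto simp: real_norm_def)
  then show thesis using that[of g' M] g'(1) M by blast
qed

lemma diffeosE:
  assumes "f \<in> diffeos \<alpha>"
  obtains f' M C where "\<And>x. x \<in> {0..1} \<Longrightarrow> (f has_real_derivative f' x) (at x within {0..1})"
    "M > 0" "\<And>x. x \<in> {0..1} \<Longrightarrow> \<bar>f' x\<bar> \<le> M"
    "\<And>x y. x \<in> {0..1} \<Longrightarrow> y \<in> {0..1} \<Longrightarrow> \<bar>f x - f y\<bar> \<le> M * \<bar>x - y\<bar>"
    "C > 0" "\<And>x y. x \<in> {0..1} \<Longrightarrow> y \<in> {0..1} \<Longrightarrow> \<bar>f' x - f' y\<bar> \<le> C * \<bar>x - y\<bar> powr \<alpha>"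
proof -
  have "C1_on {0..1} f" "Holder_deriv_on \<alpha> {0..1} f" using assms by (auto simp: diffeos_def)
  then obtain h C where h: "\<And>x. x \<in> {0..1} \<Longrightarrow> (f has_real_derivative h x) (at x within {0..1})"
    "C > 0" "\<And>x y. x \<in> {0..1} \<Longrightarrow> y \<in> {0..1} \<Longrightarrow> \<bar>h x - h y\<bar> \<le> C * \<bar>x - y\<bar> powr \<alpha>"
    unfolding Holder_deriv_on_def Holder_on_def by blast
  obtain f' M where f': "\<And>x. x \<in> {0..1} \<Longrightarrow> (f has_real_derivative f' x) (at x within {0..1})"
    "M > 0" "\<And>x. x \<in> {0..1} \<Longrightarrow> \<bar>f' x\<bar> \<le> M"
    "\<And>x y. x \<in> {0..1} \<Longrightarrow> y \<in> {0..1} \<Longrightarrow> \<bar>f x - f y\<bar> \<le> M * \<bar>x - y\<bar>"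
    using C1_on_01_bounds[OF \<open>C1_on {0..1} f\<close>] by blast
  have "h x = f' x" if "x \<in> {0..1}" for x using deriv_unique_01 h(1) f'(1) that by blast
  then show thesis using that[of f' M C] f' h by metis
qed

lemma powr_lipschitz:
  fixes M :: real
  assumes "\<bar>u\<bar> \<le> M * \<bar>v\<bar>" "M > 0" "\<alpha> \<ge> 0" 
  shows "\<bar>u\<bar> powr \<alpha> \<le> M powr \<alpha> * \<bar>v\<bar> powr \<alpha>"
  using powr_mono2[OF assms(3) _ assms(1)] assms(2) by (simp add: powr_mult)

lemma diffeos_compose:
  assumes f: "f \<in> diffeos \<alpha>" and g: "g \<in> diffeos \<alpha>" and \<alpha>: "\<alpha> \<ge> 0"
  shows "compose {0..1} f g \<in> diffeos \<alpha>"
proof -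
  let ?S = "{0..1::real}"
  have fB: "f \<in> Bij ?S" and gB: "g \<in> Bij ?S" using f g by (auto simp: diffeos_def)
  then have fb: "bij_betw f ?S ?S" and gb: "bij_betw g ?S ?S" by (auto simp: Bij_def)
  have gS: "g x \<in> ?S" if "x \<in> ?S" for x using gb that by (auto simp: bij_betw_def)
  obtain f' Mf Cf where f': "\<And>x. x \<in> ?S \<Longrightarrow> (f has_real_derivative f' x) (at x within ?S)"
    "Mf > 0" "\<And>x. x \<in> ?S \<Longrightarrow> \<bar>f' x\<bar> \<le> Mf"
    "Cf > 0" "\<And>x y. x \<in> ?S \<Longrightarrow> y \<in> ?S \<Longrightarrow> \<bar>f' x - f' y\<bar> \<le> Cf * \<bar>x - y\<bar> powr \<alpha>"
    using diffeosE[OF f] by metis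
  obtain g' Mg Cg where g': "\<And>x. x \<in> ?S \<Longrightarrow> (g has_real_derivative g' x) (at x within ?S)"
    "Mg > 0" "\<And>x. x \<in> ?S \<Longrightarrow> \<bar>g' x\<bar> \<le> Mg"
    "\<And>x y. x \<in> ?S \<Longrightarrow> y \<in> ?S \<Longrightarrow> \<bar>g x - g y\<bar> \<le> Mg * \<bar>x - y\<bar>"
    "Cg > 0" "\<And>x y. x \<in> ?S \<Longrightarrow> y \<in> ?S \<Longrightarrow> \<bar>g' x - g' y\<bar> \<le> Cg * \<bar>x - y\<bar> powr \<alpha>"
    using diffeosE[OF g] by metis
  have inv: "inv_into ?S (compose ?S f g) y = inv_into ?S g (inv_into ?S f y)" if "y \<in> ?S" for y
  proof (rule inv_into_f_eq)
    have "bij_betw (compose ?S f g) ?S ?S" using fb gb bij_betw_compose by blast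
    then show "inj_on (compose ?S f g) ?S" by (simp add: bij_betw_def)
    have 1: "inv_into ?S f y \<in> ?S" using fb that by (metis bij_betw_def inv_into_into)
    then show 2: "inv_into ?S g (inv_into ?S f y) \<in> ?S" using gb by (metis bij_betw_def inv_into_into)
    show "compose ?S f g (inv_into ?S g (inv_into ?S f y)) = y"
      using 1 2 that fb gb by (simp add: compose_def bij_betw_inv_into_right)
  qed
  have "strict_mono_on ?S (compose ?S f g)"
    using f g gS by (auto simp: diffeos_def strict_mono_on_def compose_def)
  moreover have "C1_on ?S (compose ?S f g)"
  proof (rule C1_on_compose)
    show "C1_on ?S f" "C1_on ?S g" using f g by (simp_all add: diffeos_def)
    show "g ` ?S \<subseteq> ?S" using gS by blast
  qed (simp add: compose_def)
  moreover have "C1_on ?S (inv_into ?S (compose ?S f g))"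
  proof (rule C1_on_compose[where f = "inv_into ?S g" and g = "inv_into ?S f"])
    show "C1_on ?S (inv_into ?S g)" "C1_on ?S (inv_into ?S f)"
      using f g by (simp_all add: diffeos_def)
    show "inv_into ?S f ` ?S \<subseteq> ?S"
      using bij_betw_inv_into[OF fb] by (simp add: bij_betw_def)
  qed (rule inv)
  moreover have "Holder_deriv_on \<alpha> ?S (compose ?S f g)"
    unfolding Holder_deriv_on_def
  proof (intro exI conjI ballI)
    fix x :: real assume x: "x \<in> ?S"
    have "(f has_real_derivative f' (g x)) (at (g x) within g ` ?S)"
    proof (rule DERIV_subset[OF f'(1)])
      show "g ` ?S \<subseteq> ?S" using gS by blast
    qed (rule gS[OF x])
    then have "(f \<circ> g has_real_derivative f' (g x) * g' x) (at x within ?S)"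
      using DERIV_image_chain g'(1)[OF x] by blast
    then show "(compose ?S f g has_real_derivative f' (g x) * g' x) (at x within ?S)"
      by (rule has_real_derivative_transform_on[OF x, rotated]) (simp add: compose_def)
  next
    show "Holder_on \<alpha> ?S (\<lambda>x. f' (g x) * g' x)"
      unfolding Holder_on_def
    proof (intro exI conjI ballI)
      show "0 < Cf * Mg powr \<alpha> * Mg + Mf * Cg" using f' g' by (simp add: add_pos_pos)
      fix x y :: real assume xy: "x \<in> ?S" "y \<in> ?S"
      have "f' (g x) * g' x - f' (g y) * g' y
        = (f' (g x) - f' (g y)) * g' x + f' (g y) * (g' x - g' y)" by (simp add: algebra_simps)
      then have "\<bar>f' (g x) * g' x - f' (g y) * g' y\<bar>
        \<le> \<bar>f' (g x) - f' (g y)\<bar> * \<bar>g' x\<bar> + \<bar>f' (g y)\<bar> * \<bar>g' x - g' y\<bar>"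
        by (metis abs_mult abs_triangle_ineq)
      also have "\<dots> \<le> (Cf * (Mg powr \<alpha> * \<bar>x - y\<bar> powr \<alpha>)) * Mg + Mf * (Cg * \<bar>x - y\<bar> powr \<alpha>)"
      proof (intro add_mono mult_mono)
        show "\<bar>f' (g x) - f' (g y)\<bar> \<le> Cf * (Mg powr \<alpha> * \<bar>x - y\<bar> powr \<alpha>)"
          using f'(5)[OF gS[OF xy(1)] gS[OF xy(2)]] f'(4)
            powr_lipschitz[OF g'(4)[OF xy] g'(2) \<alpha>]
          by (meson mult_left_mono order_trans less_imp_le)
      qed (use f' g' gS xy in auto)
      finally show "\<bar>f' (g x) * g' x - f' (g y) * g' y\<bar>
        \<le> (Cf * Mg powr \<alpha> * Mg + Mf * Cg) * \<bar>x - y\<bar> powr \<alpha>" by (simp add: algebra_simps)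
    qed
  qed
  ultimately show ?thesis using compose_Bij[OF fB gB] by (simp add: diffeos_def)
qed

lemma diffeos_inverse:
  assumes f: "f \<in> diffeos \<alpha>" and \<alpha>: "\<alpha> \<ge> 0"
  shows "(\<lambda>x\<in>{0..1}. inv_into {0..1} f x) \<in> diffeos \<alpha>"
proof -
  let ?S = "{0..1::real}" and ?g = "inv_into {0..1} f"
  let ?h = "\<lambda>x\<in>{0..1}. inv_into {0..1} f x"
  have fB: "f \<in> Bij ?S" using f by (auto simp: diffeos_def)
  then have fb: "bij_betw f ?S ?S" by (auto simp: Bij_def)
  have gS: "?g x \<in> ?S" and fg: "f (?g x) = x" and gf: "?g (f x) = x" and fS: "f x \<in> ?S"
    if "x \<in> ?S" for x
    using fb that by (auto simp: bij_betw_def f_inv_into_f inv_into_into intro!: inv_into_into)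
     (metis bij_betw_def fb image_eqI atLeastAtMost_iff inv_into_into)+
  obtain f' M C where f': "\<And>x. x \<in> ?S \<Longrightarrow> (f has_real_derivative f' x) (at x within ?S)"
    "C > 0" "\<And>x y. x \<in> ?S \<Longrightarrow> y \<in> ?S \<Longrightarrow> \<bar>f' x - f' y\<bar> \<le> C * \<bar>x - y\<bar> powr \<alpha>"
    using diffeosE[OF f] by metis
  have C1g: "C1_on ?S ?g" using f by (auto simp: diffeos_def)
  obtain g' M where g': "\<And>x. x \<in> ?S \<Longrightarrow> (?g has_real_derivative g' x) (at x within ?S)"
    "M > 0" "\<And>x. x \<in> ?S \<Longrightarrow> \<bar>g' x\<bar> \<le> M"
    "\<And>x y. x \<in> ?S \<Longrightarrow> y \<in> ?S \<Longrightarrow> \<bar>?g x - ?g y\<bar> \<le> M * \<bar>x - y\<bar>"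
    using C1_on_01_bounds[OF C1g] by blast
  have prod1: "f' (?g x) * g' x = 1" if x: "x \<in> ?S" for x
  proof (rule deriv_unique_01[OF _ _ x])
    have "(f has_real_derivative f' (?g x)) (at (?g x) within ?g ` ?S)"
    proof (rule DERIV_subset[OF f'(1)])
      show "?g ` ?S \<subseteq> ?S" using gS by blast
    qed (rule gS[OF x])
    then have "(f \<circ> ?g has_real_derivative f' (?g x) * g' x) (at x within ?S)"
      using DERIV_image_chain g'(1)[OF x] by blast
    then show "((\<lambda>x. x) has_real_derivative f' (?g x) * g' x) (at x within ?S)"
      by (rule has_real_derivative_transform_on[OF x, rotated]) (simp add: fg)
  qed auto
  have "strict_mono_on ?S ?h"
  proof (rule strict_mono_onI)
    fix x y :: real assume xy: "x \<in> ?S" "y \<in> ?S" "x < y"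
    have sm: "strict_mono_on ?S f" using f by (simp add: diffeos_def)
    have "\<not> ?g y \<le> ?g x"
      using strict_mono_on_leD[OF sm gS[OF xy(2)] gS[OF xy(1)]] fg xy by force
    then show "?h x < ?h y" using xy by simp
  qed
  moreover have "C1_on ?S ?h" by (rule C1_on_cong[OF C1g]) simp
  moreover have "C1_on ?S (inv_into ?S ?h)"
  proof (rule C1_on_cong)
    show "C1_on ?S f" using f by (simp add: diffeos_def)
    fix x :: real assume x: "x \<in> ?S"
    show "inv_into ?S ?h x = f x"
    proof (rule inv_into_f_eq)
      show "inj_on ?h ?S" using restrict_inv_into_Bij[OF fB] by (auto simp: Bij_def bij_betw_def)
    qed (use fS[OF x] gf[OF x] in auto)
  qed
  moreover have "Holder_deriv_on \<alpha> ?S ?h"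
    unfolding Holder_deriv_on_def
  proof (intro exI conjI ballI)
    fix x :: real assume x: "x \<in> ?S"
    show "(?h has_real_derivative g' x) (at x within ?S)"
      by (rule has_real_derivative_transform_on[OF x _ g'(1)[OF x]]) simp
  next
    show "Holder_on \<alpha> ?S g'"
      unfolding Holder_on_def
    proof (intro exI conjI ballI)
      show "0 < M * M * (C * M powr \<alpha>)" using f' g' by simp
      fix x y :: real assume xy: "x \<in> ?S" "y \<in> ?S"
      have "g' x - g' y = g' x * g' y * (f' (?g y) - f' (?g x))"
      proof -
        have "g' x * g' y * (f' (?g y) - f' (?g x))
          = g' x * (f' (?g y) * g' y) - g' y * (f' (?g x) * g' x)" by (simp add: algebra_simps)
        then show ?thesis using prod1[OF xy(1)] prod1[OF xy(2)] by simp
      qed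
      then have "\<bar>g' x - g' y\<bar> = \<bar>g' x\<bar> * \<bar>g' y\<bar> * \<bar>f' (?g x) - f' (?g y)\<bar>"
        by (simp add: abs_mult abs_minus_commute)
      also have "\<dots> \<le> M * M * (C * (M powr \<alpha> * \<bar>x - y\<bar> powr \<alpha>))"
      proof (intro mult_mono)
        show "\<bar>f' (?g x) - f' (?g y)\<bar> \<le> C * (M powr \<alpha> * \<bar>x - y\<bar> powr \<alpha>)"
          using f'(3)[OF gS[OF xy(1)] gS[OF xy(2)]] f'(2)
            powr_lipschitz[OF g'(4)[OF xy] g'(2) \<alpha>]
          by (meson mult_left_mono order_trans less_imp_le)
      qed (use f' g' xy in auto)
      finally show "\<bar>g' x - g' y\<bar> \<le> M * M * (C * M powr \<alpha>) * \<bar>x - y\<bar> powr \<alpha>"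
        by (simp add: algebra_simps)
    qed
  qed
  ultimately show ?thesis using restrict_inv_into_Bij[OF fB] by (simp add: diffeos_def)
qed

lemma diffeos_id: "(\<lambda>x\<in>{0..1}. x) \<in> diffeos \<alpha>"
proof -
  let ?S = "{0..1::real}"
  have C1: "C1_on ?S (\<lambda>x. x)" by (auto simp: C1_on_def intro!: exI[of _ "\<lambda>_. 1"])
  have inv: "inv_into ?S (\<lambda>x\<in>?S. x) x = x" if "x \<in> ?S" for x
    by (rule inv_into_f_eq) (use that in \<open>auto simp: inj_on_def\<close>)
  have "((\<lambda>x\<in>?S. x) has_real_derivative 1) (at x within ?S)" if "x \<in> ?S" for x
    by (rule has_real_derivative_transform_on[OF that _ DERIV_ident]) simp
  then have "Holder_deriv_on \<alpha> ?S (\<lambda>x\<in>?S. x)"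
    unfolding Holder_deriv_on_def Holder_on_def
    by (intro exI[of _ "\<lambda>_. 1"] conjI) (auto intro!: exI[of _ 1])
  then show ?thesis
    using C1_on_cong[OF C1, of "\<lambda>x\<in>?S. x"] C1_on_cong[OF C1, of "inv_into ?S (\<lambda>x\<in>?S. x)"] inv
    by (simp add: diffeos_def id_Bij strict_mono_on_def)
qed

lemma group_Diff_group:
  assumes "\<alpha> \<ge> 0"
  shows "group (Diff_group \<alpha>)"
proof -
  interpret B: group "BijGroup {0..1::real}" by (rule group_BijGroup)
  have sub: "f \<in> Bij {0..1}" if "f \<in> diffeos \<alpha>" for f using that by (simp add: diffeos_def)
  have "subgroup (diffeos \<alpha>) (BijGroup {0..1})"
  proof
    show "diffeos \<alpha> \<subseteq> carrier (BijGroup {0..1})" using sub by (auto simp: BijGroup_def)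
    show "x \<otimes>\<^bsub>BijGroup {0..1}\<^esub> y \<in> diffeos \<alpha>" if "x \<in> diffeos \<alpha>" "y \<in> diffeos \<alpha>" for x y
      using diffeos_compose[OF that assms] sub that by (simp add: BijGroup_def)
    show "\<one>\<^bsub>BijGroup {0..1}\<^esub> \<in> diffeos \<alpha>" using diffeos_id by (simp add: BijGroup_def)
    show "inv\<^bsub>BijGroup {0..1}\<^esub> x \<in> diffeos \<alpha>" if "x \<in> diffeos \<alpha>" for x
      using diffeos_inverse[OF that assms] inv_BijGroup[OF sub[OF that]] by simp
  qed
  then show ?thesis unfolding Diff_group_def by (rule B.subgroup_imp_group)
qed

end

theory Submission
  imports Defs "HOL-Real_Asymp.Real_Asymp"
begin

text \<open>The group acts on \<open>\<int> \<times> \<int> \<times> \<real>\<close>, preserving the lexicographic order, in such a way that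
  the matrices differing from the identity only in the lower left \<open>2 \<times> 2\<close> block, which form an
  abelian normal subgroup, act on each line over \<open>(i, j)\<close> by a translation. An
  element moves \<open>(i, j, s)\<close> to \<open>(i + a, j + f, s + T i j)\<close>, where \<open>T\<close> has degree at most one in each
  of \<open>i\<close> and \<open>j\<close>. Squeeze the line over \<open>(i, j)\<close> into an interval of length proportional to
  \<open>m\<^sup>-\<^sup>1\<^sup>/\<^sup>\<alpha>\<close>, where \<open>m = 1 + \<bar>i\<bar> + \<bar>j\<bar>\<close>; these lengths are summable exactly because \<open>1/\<alpha> > 2\<close>. Let
  the squeezing have derivative \<open>(\<mu>\<^sup>2 + s\<^sup>2)\<^sup>-\<^sup>3\<^sup>/\<^sup>4\<close>, up to a constant factor, with \<open>\<mu> = m\<^sup>2\<^sup>/\<^sup>\<alpha>\<close>. Its tails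
  do not depend on the interval, so every group element has derivative tending to 1 at the ends of
  all intervals. On an interval this derivative has a Lipschitz constant of order \<open>1/m\<close> divided by
  the length. As \<open>1/m\<close> is of the order of the \<open>\<alpha>\<close>-th power of the length, the derivative is
  \<open>\<alpha>\<close>-Hoelder with a constant independent of the interval, and hence on all of \<open>[0, 1]\<close>.\<close>

section \<open>Functions differentiable off a countable set\<close>

text \<open>If \<open>h\<close> fell from \<open>a\<close> to \<open>b\<close>, some level
  \<open>y\<close> strictly in between would avoid the countable image of \<open>S\<close>. At the
  last point where \<open>h\<close> takes the value \<open>y\<close> the derivative is positive, so
  \<open>h\<close> rises above \<open>y\<close> and has to cross it again later, a
  contradiction.\<close>

lemma increasing_if_deriv_pos_off_countable:
  fixes h :: "real \<Rightarrow> real"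
  assumes cont: "continuous_on {a..b} h" and ab: "a \<le> b" and S: "countable S"
    and deriv: "\<And>x. x \<in> {a<..<b} - S \<Longrightarrow> \<exists>d>0. (h has_real_derivative d) (at x)"
  shows "h a \<le> h b"
proof (rule ccontr)
  assume "\<not> h a \<le> h b"
  then have "uncountable {h b<..<h a}" by (simp add: uncountable_open_interval)
  then have "\<not> {h b<..<h a} \<subseteq> h ` S" using S by (metis countable_image countable_subset)
  then obtain y where "y \<in> {h b<..<h a}" "y \<notin> h ` S" by blast
  then have y: "h b < y" "y < h a" "y \<notin> h ` S" by auto
  define Z where "Z = {t \<in> {a..b}. h t = y}"
  have "closed Z" unfolding Z_def by (rule continuous_closed_preimage_constant[OF cont]) simp
  moreover have bdd: "bdd_above Z" unfolding Z_def by (auto intro: bdd_aboveI[of _ b])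
  moreover have "Z \<noteq> {}"
  proof -
    obtain t where "a \<le> t" "t \<le> b" "h t = y"
      using IVT2'[OF less_imp_le[OF y(1)] less_imp_le[OF y(2)] ab cont] by blast
    then show ?thesis unfolding Z_def by force
  qed
  ultimately have "Sup Z \<in> Z" by (intro closed_contains_Sup)
  then obtain x where "x \<in> Z" and x_max: "\<And>t. t \<in> Z \<Longrightarrow> t \<le> x"
    using cSup_upper[OF _ bdd] by blast
  then have x: "a \<le> x" "x \<le> b" "h x = y" by (auto simp: Z_def)
  have "x \<noteq> a" "x \<noteq> b" "x \<notin> S" using x(3) y by blast+
  then have xab: "a < x" "x < b" using x by linarith+
  obtain d where d: "d > 0" "(h has_real_derivative d) (at x)"
    using deriv[of x] xab \<open>x \<notin> S\<close> by auto
  obtain e where e: "e > 0" "\<And>k. 0 < k \<Longrightarrow> k < e \<Longrightarrow> h x < h (x + k)"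
    using DERIV_pos_inc_right[OF d(2,1)] by blast
  define t where "t = x + min (e / 2) (b - x)"
  have t: "x < t" "t \<le> b" using e(1) xab by (auto simp: t_def)
  have "h x < h t" unfolding t_def using e(1) xab by (intro e(2)) auto
  moreover have "continuous_on {t..b} h" using cont by (rule continuous_on_subset) (use t xab in auto)
  ultimately obtain z where z: "t \<le> z" "z \<le> b" "h z = y"
    using IVT2'[of h b y t] t y x(3) by auto
  then have "z \<in> Z" using t xab by (auto simp: Z_def)
  then show False using x_max[of z] z(1) t(1) by linarith
qed

text \<open>Adding a small positive slope to \<open>h\<close> or to its negative makes the
  derivative positive, so the increasing case applies; letting the slope tend to 0 gives both
  inequalities.\<close>

lemma constant_if_deriv_0_off_countable:
  fixes h :: "real \<Rightarrow> real"
  assumes cont: "continuous_on {a..b} h" and ab: "a \<le> b" and S: "countable S"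
    and deriv: "\<And>x. x \<in> {a<..<b} - S \<Longrightarrow> (h has_real_derivative 0) (at x)"
  shows "h a = h b"
proof -
  have "\<sigma> * h a \<le> \<sigma> * h b + e" if "e > 0" for \<sigma> e
  proof -
    \<comment> \<open>The summand 1 keeps the denominator positive when
      \<open>a = b\<close>.\<close>
    define \<epsilon> where "\<epsilon> = e / (b - a + 1)"
    have \<epsilon>: "\<epsilon> > 0" using that ab by (simp add: \<epsilon>_def)
    have "\<sigma> * h a + \<epsilon> * a \<le> \<sigma> * h b + \<epsilon> * b"
    proof (rule increasing_if_deriv_pos_off_countable[OF _ ab S])
      show "continuous_on {a..b} (\<lambda>x. \<sigma> * h x + \<epsilon> * x)" by (intro continuous_intros cont)
      show "\<exists>d>0. ((\<lambda>x. \<sigma> * h x + \<epsilon> * x) has_real_derivative d) (at x)" if "x \<in> {a<..<b} - S" for x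
        using \<epsilon> by (intro exI[of _ \<epsilon>]) (auto intro!: derivative_eq_intros deriv[OF that])
    qed
    moreover have "\<epsilon> * (b - a) \<le> e"
      using that ab by (simp add: \<epsilon>_def field_simps)
    ultimately show ?thesis by (simp add: algebra_simps)
  qed
  note approx = this
  show ?thesis
  proof (rule antisym; rule field_le_epsilon)
    show "h a \<le> h b + e" "h b \<le> h a + e" if "e > 0" for e
      using approx[OF that, of 1] approx[OF that, of "-1"] by linarith+
  qed
qed

text \<open>The difference of \<open>f\<close> and the integral of \<open>D\<close> is constant, so
  at the points of \<open>S\<close> and at the ends of the interval the derivative comes from the
  fundamental theorem of calculus.\<close>

lemma has_derivative_if_off_countable:
  fixes f D :: "real \<Rightarrow> real"
  assumes f: "continuous_on {a..b} f" and D: "continuous_on {a..b} D" and S: "countable S"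
    and deriv: "\<And>x. x \<in> {a<..<b} - S \<Longrightarrow> (f has_real_derivative D x) (at x)"
    and x: "x \<in> {a..b}"
  shows "(f has_real_derivative D x) (at x within {a..b})"
proof -
  define E where "E x = f x - integral {a..x} D" for x
  have I: "((\<lambda>x. integral {a..x} D) has_real_derivative D x) (at x within {a..b})" if "x \<in> {a..b}" for x
    by (rule integral_has_real_derivative[OF D that])
  have const: "E a = E t" if t: "t \<in> {a..b}" for t
  proof (rule constant_if_deriv_0_off_countable[where h = E, OF _ _ S])
    have "continuous_on {a..b} (\<lambda>x. integral {a..x} D)" using I by (rule DERIV_continuous_on)
    then have "continuous_on {a..b} E" unfolding E_def by (intro continuous_intros f)
    then show "continuous_on {a..t} E" by (rule continuous_on_subset) (use t in auto)
    show "(E has_real_derivative 0) (at x)" if x: "x \<in> {a<..<t} - S" for x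
    proof -
      have xab: "x \<in> {a<..<b}" using x t by auto
      then have "((\<lambda>x. integral {a..x} D) has_real_derivative D x) (at x)"
        using I[of x] at_within_Icc_at[of a x b] by simp
      then show ?thesis
        unfolding E_def using deriv[of x] x xab by (auto intro!: derivative_eq_intros)
    qed
  qed (use t in auto)
  have "f t = E a + integral {a..t} D" if "t \<in> {a..b}" for t
    using const[OF that] E_def[of t] by linarith
  then show ?thesis
  proof (rule has_real_derivative_transform_on[OF x])
    show "((\<lambda>t. E a + integral {a..t} D) has_real_derivative D x) (at x within {a..b})"
      by (auto intro!: derivative_eq_intros I x)
  qed
qed

section \<open>The profile and the tiling of the interval\<close>

text \<open>The total mass of the density is finite because it decays like |s|^(-3/2); an affine
  change of an antiderivative moves its limits to 0 and 1.\<close>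

lemma profile_exists:
  obtains c :: real and G where "c > 0"
    "\<And>s. (G has_real_derivative c * (1 + s\<^sup>2) powr (-3/4)) (at s)"
    "(G \<longlongrightarrow> 0) at_bot" "(G \<longlongrightarrow> 1) at_top"
proof -
  let ?L = "\<lambda>s::real. (1 + s\<^sup>2) powr (-3/4)"
  have pos: "1 + s\<^sup>2 > 0" for s :: real by (simp add: add_pos_nonneg)
  have "\<exists>F. \<forall>x::real. -\<infinity> < ereal x \<longrightarrow> ereal x < \<infinity> \<longrightarrow> (F has_vector_derivative ?L x) (at x)"
    using pos by (intro einterval_antiderivative) (auto intro!: continuous_intros simp: less_imp_neq[symmetric])
  then obtain H where H: "(H has_real_derivative ?L s) (at s)" for s
    by (auto simp: has_real_derivative_iff_has_vector_derivative)
  have H_mono: "H s < H t" if "s < t" for s t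
    using that H pos by (intro DERIV_pos_imp_increasing[OF that]) (metis powr_gt_zero less_irrefl)
  have L_le: "?L s \<le> 2 * (1 + \<bar>s\<bar>) powr (-3/2)" for s
  proof -
    have two: "(2::real) powr (3/4) \<le> 2" using powr_mono[of "3/4" 1 "2::real"] by simp
    have "(1 + \<bar>s\<bar>)\<^sup>2 / 2 \<le> 1 + s\<^sup>2"
      using zero_le_power2[of "1 - \<bar>s\<bar>"] by (simp add: power2_eq_square algebra_simps)
    then have "?L s \<le> ((1 + \<bar>s\<bar>)\<^sup>2 / 2) powr (-3/4)"
      by (intro powr_mono2') auto
    also have "\<dots> = ((1 + \<bar>s\<bar>)\<^sup>2) powr (-3/4) * 2 powr (3/4)"
      by (simp add: powr_divide powr_minus field_simps)
    also have "((1 + \<bar>s\<bar>)\<^sup>2) powr (-3/4) = (1 + \<bar>s\<bar>) powr (-3/2)"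
      by (simp add: powr_powr flip: powr_numeral)
    also have "(1 + \<bar>s\<bar>) powr (-3/2) * 2 powr (3/4) \<le> (1 + \<bar>s\<bar>) powr (-3/2) * 2"
      using two by (intro mult_left_mono) auto
    finally show ?thesis by (simp only: mult.commute)
  qed
  \<comment> \<open>The added term has derivative -2 (1 + x)^(-3/2), which by \<open>L_le\<close>
    outweighs the derivative of \<open>H\<close>. The sum is therefore nonincreasing and bounds
    \<open>H\<close> from above; \<open>left\<close> is the mirror image.\<close>
  have right: "H s + 4 * (1 + s) powr (-1/2) \<le> H 0 + 4" if "s \<ge> 0" for s
  proof -
    have "H s + 4 * (1 + s) powr (-1/2) \<le> H 0 + 4 * (1 + 0) powr (-1/2)"
    proof (rule DERIV_nonpos_imp_nonincreasing[OF that])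
      fix x :: real assume x: "0 \<le> x" "x \<le> s"
      have "((\<lambda>s. H s + 4 * (1 + s) powr (-1/2)) has_real_derivative
          ?L x + 4 * ((-1/2) * (1 + x) powr (-1/2 - 1))) (at x)"
        using x by (auto intro!: derivative_eq_intros H)
      moreover have "?L x + 4 * ((-1/2) * (1 + x) powr (-1/2 - 1)) \<le> 0"
        using L_le[of x] x by simp
      ultimately show "\<exists>y. ((\<lambda>s. H s + 4 * (1 + s) powr (-1/2)) has_real_derivative y) (at x) \<and> y \<le> 0"
        by blast
    qed
    then show ?thesis by simp
  qed
  have left: "H 0 - 4 \<le> H s - 4 * (1 - s) powr (-1/2)" if "s \<le> 0" for s
  proof -
    have "H 0 - 4 * (1 - 0) powr (-1/2) \<le> H s - 4 * (1 - s) powr (-1/2)"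
    proof (rule DERIV_nonpos_imp_nonincreasing[OF that])
      fix x :: real assume x: "s \<le> x" "x \<le> 0"
      have "((\<lambda>s. H s - 4 * (1 - s) powr (-1/2)) has_real_derivative
          ?L x - 4 * ((1/2) * (1 - x) powr (-1/2 - 1))) (at x)"
        using x by (auto intro!: derivative_eq_intros H)
      moreover have "?L x - 4 * ((1/2) * (1 - x) powr (-1/2 - 1)) \<le> 0"
        using L_le[of x] x by simp
      ultimately show "\<exists>y. ((\<lambda>s. H s - 4 * (1 - s) powr (-1/2)) has_real_derivative y) (at x) \<and> y \<le> 0"
        by blast
    qed
    then show ?thesis by simp
  qed
  have up: "H s \<le> H 0 + 4" for s
    using right[of s] H_mono[of s 0] powr_ge_zero[of "1+s" "-1/2"] by (cases "s \<ge> 0") linarith+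
  have lo: "H 0 - 4 \<le> H s" for s
    using left[of s] H_mono[of 0 s] powr_ge_zero[of "1-s" "-1/2"] by (cases "s \<le> 0") linarith+
  define p q where "p = Inf (range H)" and "q = Sup (range H)"
  have bd: "bdd_above (range H)" "bdd_below (range H)"
    using up lo by (auto intro!: bdd_aboveI bdd_belowI)
  have pq: "p \<le> H s" "H s \<le> q" for s
    using bd by (auto simp: p_def q_def intro: cInf_lower cSup_upper)
  have "p < q" using pq[of 0] pq[of 1] H_mono[of 0 1] by linarith
  have at_top: "(H \<longlongrightarrow> q) at_top"
  proof (rule order_tendstoI)
    fix y assume "y < q"
    then obtain t where "y < H t" unfolding q_def by (auto simp: less_cSup_iff[OF _ bd(1)])
    then show "\<forall>\<^sub>F s in at_top. y < H s"
      unfolding eventually_at_top_linorder using H_mono by (metis less_trans order_le_less)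
  next
    fix y assume "q < y"
    then have "H s < y" for s using pq(2)[of s] by linarith
    then show "\<forall>\<^sub>F s in at_top. H s < y" by simp
  qed
  have at_bot: "(H \<longlongrightarrow> p) at_bot"
  proof (rule order_tendstoI)
    fix y assume "p < y"
    then obtain t where "H t < y" unfolding p_def by (auto simp: cInf_less_iff[OF _ bd(2)])
    then show "\<forall>\<^sub>F s in at_bot. H s < y"
      unfolding eventually_at_bot_linorder using H_mono by (metis less_trans order_le_less)
  next
    fix y assume "y < p"
    then have "y < H s" for s using pq(1)[of s] by linarith
    then show "\<forall>\<^sub>F s in at_bot. y < H s" by simp
  qed
  show thesis
  proof
    show "1 / (q - p) > 0" using \<open>p < q\<close> by simp
    show "((\<lambda>s. (H s - p) / (q - p)) has_real_derivative 1 / (q - p) * ?L s) (at s)" for s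
      using \<open>p < q\<close> by (auto intro!: derivative_eq_intros H)
    show "((\<lambda>s. (H s - p) / (q - p)) \<longlongrightarrow> 0) at_bot"
      using \<open>p < q\<close> by (auto intro!: tendsto_eq_intros at_bot)
    show "((\<lambda>s. (H s - p) / (q - p)) \<longlongrightarrow> 1) at_top"
      using \<open>p < q\<close> by (auto intro!: tendsto_eq_intros at_top)
  qed
qed

text \<open>Takes \<open>u i\<close> to be the sum of \<open>a\<close> over all integers below
  \<open>i\<close>. For \<open>x\<close> strictly between 0 and the total, finite sums close enough
  to the total give an index \<open>k\<close> with \<open>u k\<close> above \<open>x\<close> and an
  index \<open>l\<close> with \<open>u l\<close> below it; a walk from \<open>l\<close> to
  \<open>k\<close> crosses \<open>x\<close>.\<close>

lemma int_partition:
  fixes a :: "int \<Rightarrow> real"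
  assumes pos: "\<And>i. a i > 0" and sum: "a summable_on UNIV"
  obtains u where "\<And>i. u (i + 1) = u i + a i" "\<And>i j. i \<le> j \<Longrightarrow> u i \<le> u j" "\<And>i. u i > 0" "\<And>i. u i < infsum a UNIV"
    "\<And>x. 0 < x \<Longrightarrow> x < infsum a UNIV \<Longrightarrow> \<exists>i. u i \<le> x \<and> x < u (i + 1)"
proof -
  define u where "u i = infsum a {..<i}" for i
  have s: "a summable_on X" for X using sum by (rule summable_on_subset_banach) simp
  have step: "u (i + 1) = u i + a i" for i
  proof -
    have "{..<i + 1} = insert i {..<i}" by auto
    then show ?thesis using infsum_insert[OF s[of "{..<i}"], of i] by (simp add: u_def add.commute)
  qed
  have mono: "u i \<le> u j" if "i \<le> j" for i j
    unfolding u_def using that pos by (intro infsum_mono_neutral s) (auto simp: less_imp_le)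
  have u0: "u i \<ge> 0" for i unfolding u_def using pos by (intro infsum_nonneg) (simp add: less_imp_le)
  have up: "u i > 0" for i using step[of "i - 1"] u0[of "i - 1"] pos[of "i - 1"] by simp
  have le_sum: "sum a F \<le> infsum a X" if "finite F" "F \<subseteq> X" for F X
    using that s pos by (intro finite_sum_le_infsum) (auto simp: less_imp_le)
  have uS: "u i + infsum a {i..} = infsum a UNIV" for i
  proof -
    have "{..<i} \<union> {i..} = UNIV" "{..<i} \<inter> {i..} = {}" by auto
    then show ?thesis
      using infsum_Un_disjoint[OF s[of "{..<i}"] s[of "{i..}"]] unfolding u_def by simp
  qed
  have ub: "u i < infsum a UNIV" for i
    using uS[of i] le_sum[of "{i}" "{i..}"] pos[of i] by simp
  have large: "\<exists>F. finite F \<and> y < sum a F" if "y < infsum a UNIV" for y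
    using order_tendstoD(1)[OF infsum_tendsto[OF sum] that] eventually_finite_subsets_at_top_weakI
    by (auto simp: eventually_finite_subsets_at_top)
  have cross: "\<exists>i. u i \<le> x \<and> x < u (i + 1)" if x: "0 < x" "x < infsum a UNIV" for x
  proof -
    obtain F where F: "finite F" "x < sum a F" using large[OF x(2)] by blast
    obtain k where k: "F \<subseteq> {..<k}"
    proof
      show "F \<subseteq> {..<Max F + 1}" using F(1) by (auto simp: zless_add1_eq le_less[symmetric])
    qed
    have xk: "x < u k" using F le_sum[OF F(1) k] by (simp add: u_def)
    obtain F' where F': "finite F'" "infsum a UNIV - x < sum a F'" using large[of "infsum a UNIV - x"] x by auto
    obtain l where l: "F' \<subseteq> {l..}"
      using F'(1) by (metis atLeast_iff bdd_below.unfold bdd_below_finite subsetI)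
    have xl: "u l < x" using F' le_sum[OF F'(1) l] uS[of l] by simp
    have "u l \<le> x \<longrightarrow> x < u (l + int n) \<longrightarrow> (\<exists>i. u i \<le> x \<and> x < u (i + 1))" for n
    proof (induction n)
      case (Suc n)
      then show ?case by (metis add.assoc add.commute not_le of_nat_Suc)
    qed auto
    moreover have "l < k"
      using mono[of k l] xk xl by (cases "l < k") auto
    then have "k = l + int (nat (k - l))" by simp
    ultimately show ?thesis using xk xl by (metis less_imp_le)
  qed
  show thesis using that[of u] step mono up ub cross by blast
qed

text \<open>Here \<mu> and \<mu>' stand for the scales of a cell and of its image, \<open>T\<close>
  for the translation and \<open>m\<close> for the size of the index. All perturbations have
  relative size \<open>1 / m\<close>, and this factor survives in the derivative of the ratio. The
  constant depends on \<open>K\<close> alone, hence serves all cells at once; the last factor of the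
  bound is, up to a constant, the derivative of the squeezing.\<close>

lemma shift_ratio_deriv_bound:
  fixes K :: real
  assumes "K \<ge> 1"
  obtains C where "C > 0"
    "\<And>\<mu> \<mu>' T m s :: real. \<lbrakk>\<mu> > 0; \<mu>' > 0; m \<ge> 1; \<mu>' \<le> K * \<mu>; \<mu> \<le> K * \<mu>';
        \<bar>\<mu>' - \<mu>\<bar> \<le> K * \<mu> / m; \<bar>T\<bar> \<le> K * \<mu> / m\<rbrakk>
      \<Longrightarrow> \<exists>D. ((\<lambda>s. ((\<mu>\<^sup>2 + s\<^sup>2) / (\<mu>'\<^sup>2 + (s + T)\<^sup>2)) powr (3/4)) has_real_derivative D) (at s)
        \<and> \<bar>D\<bar> \<le> C * (sqrt \<mu> / m) * (\<mu>\<^sup>2 + s\<^sup>2) powr (-3/4)"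
proof -
  \<comment> \<open>Large enough for \<open>P\<close> and \<open>E\<close> to bound each other up to
    the factor \<open>c\<close>, as shown in \<open>PE\<close> and \<open>EP\<close>.\<close>
  define c where "c = 5 * K^4"
  have c1: "c \<ge> 1" using one_le_power[OF assms, of 4] by (simp add: c_def)
  have "\<exists>D. ((\<lambda>s. ((\<mu>\<^sup>2 + s\<^sup>2) / (\<mu>'\<^sup>2 + (s + T)\<^sup>2)) powr (3/4)) has_real_derivative D) (at s)
        \<and> \<bar>D\<bar> \<le> (3 * c^3 * (K\<^sup>2 + K)) * (sqrt \<mu> / m) * (\<mu>\<^sup>2 + s\<^sup>2) powr (-3/4)"
    if \<mu>: "\<mu> > 0" "\<mu>' > 0" and m: "m \<ge> 1" and K: "\<mu>' \<le> K * \<mu>" "\<mu> \<le> K * \<mu>'"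
      and d: "\<bar>\<mu>' - \<mu>\<bar> \<le> K * \<mu> / m" and T: "\<bar>T\<bar> \<le> K * \<mu> / m" for \<mu> \<mu>' T m s :: real
  proof -
    define P where "P = \<mu>\<^sup>2 + s\<^sup>2"
    define E where "E = \<mu>'\<^sup>2 + (s + T)\<^sup>2"
    \<comment> \<open>The numerator of the quotient rule for \<open>P / E\<close> after
      cancellation; every remaining term contains \<open>T\<close> or the difference of the squared
      scales, so it is small.\<close>
    define N where "N = 2 * (s * (\<mu>'\<^sup>2 - \<mu>\<^sup>2) + T * s\<^sup>2 + s * T\<^sup>2 - T * \<mu>\<^sup>2)"
    define D where "D = 3/4 * (P / E) powr (-1/4) * (N / E\<^sup>2)"
    have P0: "P > 0" and E0: "E > 0" using \<mu> by (simp_all add: P_def E_def add_pos_nonneg)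
    have T': "\<bar>T\<bar> \<le> K * \<mu>"
    proof -
      have "K * \<mu> / m \<le> K * \<mu> / 1" using m \<mu> assms by (intro divide_left_mono) auto
      with T show ?thesis by simp
    qed
    have T2: "T\<^sup>2 \<le> K\<^sup>2 * \<mu>\<^sup>2" using power_mono[OF T', of 2] by (simp add: power_mult_distrib)
    have K2: "\<mu>'\<^sup>2 \<le> K\<^sup>2 * \<mu>\<^sup>2" "\<mu>\<^sup>2 \<le> K\<^sup>2 * \<mu>'\<^sup>2"
      using power_mono[OF K(1), of 2] power_mono[OF K(2), of 2] \<mu> by (simp_all add: power_mult_distrib)
    have KK: "1 \<le> K\<^sup>2" "K\<^sup>2 \<le> K^4" using assms by (auto intro: power_increasing)
    have PE: "P \<le> c * E"
    proof -
      have "s\<^sup>2 \<le> 2 * (s + T)\<^sup>2 + 2 * T\<^sup>2"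
        using zero_le_power2[of "s + 2 * T"] by (simp add: power2_eq_square algebra_simps)
      moreover have "K\<^sup>2 * \<mu>\<^sup>2 \<le> K^4 * \<mu>'\<^sup>2"
        using mult_left_mono[OF K2(2), of "K\<^sup>2"] by (simp add: power2_eq_square power4_eq_xxxx mult.assoc)
      moreover have "K\<^sup>2 * \<mu>'\<^sup>2 \<le> K^4 * \<mu>'\<^sup>2" using KK by (intro mult_right_mono) auto
      moreover have "1 * (s + T)\<^sup>2 \<le> K^4 * (s + T)\<^sup>2" using KK by (intro mult_right_mono) auto
      moreover have "1 * \<mu>'\<^sup>2 \<le> K^4 * \<mu>'\<^sup>2" using KK by (intro mult_right_mono) auto
      moreover have "c * E = 5 * (K^4 * \<mu>'\<^sup>2) + 5 * (K^4 * (s + T)\<^sup>2)" by (simp add: c_def E_def algebra_simps)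
      ultimately show ?thesis
        using K2 T2 zero_le_power2[of "s + T"] zero_le_power2[of "\<mu>'"] unfolding P_def by linarith
    qed
    have EP: "E \<le> c * P"
    proof -
      have "(s + T)\<^sup>2 \<le> 2 * s\<^sup>2 + 2 * T\<^sup>2"
        using zero_le_power2[of "s - T"] by (simp add: power2_eq_square algebra_simps)
      moreover have "K\<^sup>2 * \<mu>\<^sup>2 \<le> K^4 * \<mu>\<^sup>2" using KK by (intro mult_right_mono) auto
      moreover have "1 * s\<^sup>2 \<le> K^4 * s\<^sup>2" using KK by (intro mult_right_mono) auto
      moreover have "0 \<le> K^4 * \<mu>\<^sup>2" by simp
      moreover have "c * P = 5 * (K^4 * \<mu>\<^sup>2) + 5 * (K^4 * s\<^sup>2)" by (simp add: c_def P_def algebra_simps)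
      ultimately show ?thesis using K2 T2 zero_le_power2[of s] unfolding E_def by linarith
    qed
    have sP: "\<bar>s\<bar> * \<mu> \<le> P"
    proof -
      have "0 \<le> \<bar>s\<bar> * \<mu>" using \<mu> by simp
      then show ?thesis using sum_squares_bound[of "\<bar>s\<bar>" \<mu>] unfolding P_def power2_abs by linarith
    qed
    have N: "\<bar>N\<bar> \<le> 4 * (K\<^sup>2 + K) * (\<mu> / m) * P"
    proof -
      have km: "0 \<le> K * \<mu> / m" using \<mu> m assms by simp
      have "\<bar>s * (\<mu>'\<^sup>2 - \<mu>\<^sup>2)\<bar> = \<bar>s\<bar> * (\<bar>\<mu>' - \<mu>\<bar> * (\<mu>' + \<mu>))"
        using \<mu> by (simp add: power2_eq_square abs_mult square_diff_square_factored mult.commute)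
      also have "\<dots> \<le> \<bar>s\<bar> * ((K * \<mu> / m) * (K * \<mu> + \<mu>))"
        using d K(1) \<mu> km by (intro mult_left_mono mult_mono) auto
      also have "\<dots> = (K * (K + 1) * (\<mu> / m)) * (\<bar>s\<bar> * \<mu>)" by (simp add: algebra_simps add_divide_distrib)
      also have "\<dots> \<le> (K * (K + 1) * (\<mu> / m)) * P"
        using sP \<mu> m assms by (intro mult_left_mono) auto
      finally have 1: "\<bar>s * (\<mu>'\<^sup>2 - \<mu>\<^sup>2)\<bar> \<le> (K * (K + 1) * (\<mu> / m)) * P" .
      have "\<bar>T * s\<^sup>2\<bar> + \<bar>T * \<mu>\<^sup>2\<bar> = \<bar>T\<bar> * P" by (simp add: P_def abs_mult algebra_simps)
      also have "\<dots> \<le> (K * \<mu> / m) * P" using T P0 by (intro mult_right_mono) auto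
      finally have 2: "\<bar>T * s\<^sup>2\<bar> + \<bar>T * \<mu>\<^sup>2\<bar> \<le> (K * (\<mu> / m)) * P" by simp
      have "\<bar>s * T\<^sup>2\<bar> = \<bar>s\<bar> * (\<bar>T\<bar> * \<bar>T\<bar>)" by (simp add: abs_mult power2_eq_square)
      also have "\<dots> \<le> \<bar>s\<bar> * ((K * \<mu> / m) * (K * \<mu>))"
        using T T' km by (intro mult_left_mono mult_mono) auto
      also have "\<dots> = (K * K * (\<mu> / m)) * (\<bar>s\<bar> * \<mu>)" by (simp add: algebra_simps add_divide_distrib)
      also have "\<dots> \<le> (K * K * (\<mu> / m)) * P"
        using sP \<mu> m assms by (intro mult_left_mono) auto
      finally have 3: "\<bar>s * T\<^sup>2\<bar> \<le> (K * K * (\<mu> / m)) * P" .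
      have "\<bar>N\<bar> \<le> 2 * (\<bar>s * (\<mu>'\<^sup>2 - \<mu>\<^sup>2)\<bar> + (\<bar>T * s\<^sup>2\<bar> + \<bar>T * \<mu>\<^sup>2\<bar>) + \<bar>s * T\<^sup>2\<bar>)"
      proof -
        have "\<bar>x + y + z - t\<bar> \<le> \<bar>x\<bar> + (\<bar>y\<bar> + \<bar>t\<bar>) + \<bar>z\<bar>" for x y z t :: real by linarith
        then show ?thesis unfolding N_def by (subst abs_mult) (simp only: abs_numeral, intro mult_left_mono, auto)
      qed
      also have "\<dots> \<le> 2 * ((K * (K + 1) * (\<mu> / m)) * P + (K * (\<mu> / m)) * P + (K * K * (\<mu> / m)) * P)"
        using 1 2 3 by (intro mult_left_mono add_mono) auto
      also have "\<dots> = 4 * (K\<^sup>2 + K) * (\<mu> / m) * P" by (simp add: algebra_simps add_divide_distrib power2_eq_square)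
      finally show ?thesis .
    qed
    have der: "((\<lambda>s. ((\<mu>\<^sup>2 + s\<^sup>2) / (\<mu>'\<^sup>2 + (s + T)\<^sup>2)) powr (3/4)) has_real_derivative D) (at s)"
    proof -
      have "((\<lambda>s. (\<mu>\<^sup>2 + s\<^sup>2) / (\<mu>'\<^sup>2 + (s + T)\<^sup>2)) has_real_derivative
          ((2 * s) * E - P * (2 * (s + T))) / (E * E)) (at s)"
        using E0 unfolding E_def P_def by (auto intro!: derivative_eq_intros)
      moreover have "(2 * s) * E - P * (2 * (s + T)) = N"
        by (simp add: N_def E_def P_def power2_eq_square algebra_simps)
      ultimately have "((\<lambda>s. (\<mu>\<^sup>2 + s\<^sup>2) / (\<mu>'\<^sup>2 + (s + T)\<^sup>2)) has_real_derivative N / E\<^sup>2) (at s)"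
        by (simp add: power2_eq_square)
      from DERIV_fun_powr[OF this, of "3/4"] show ?thesis
        using P0 E0 by (simp add: D_def flip: P_def E_def)
    qed
    have q: "(P / E) powr (-1/4) \<le> c"
    proof -
      have "(P / E) powr (-1/4) = (E / P) powr (1/4)"
        using P0 E0 by (simp add: powr_divide powr_minus field_simps)
      also have "\<dots> \<le> c powr (1/4)"
        using EP P0 E0 by (intro powr_mono2) (auto simp: field_simps)
      also have "\<dots> \<le> c powr 1" using c1 by (intro powr_mono) auto
      finally show ?thesis using c1 by simp
    qed
    have "\<bar>N / E\<^sup>2\<bar> \<le> 4 * (K\<^sup>2 + K) * (\<mu> / m) * P / (P / c)\<^sup>2"
    proof -
      have "P / c \<le> E" using PE c1 by (simp add: field_simps)
      then have "(P / c)\<^sup>2 \<le> E\<^sup>2" using P0 c1 by (intro power_mono) auto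
      moreover have "(P / c)\<^sup>2 > 0" using P0 c1 by simp
      ultimately show ?thesis unfolding abs_divide using N by (intro frac_le) auto
    qed
    also have "\<dots> = 4 * (K\<^sup>2 + K) * c\<^sup>2 * (\<mu> / m) * (1 / P)"
      using P0 c1 m by (simp add: field_simps power2_eq_square)
    finally have N': "\<bar>N / E\<^sup>2\<bar> \<le> 4 * (K\<^sup>2 + K) * c\<^sup>2 * (\<mu> / m) * (1 / P)" .
    \<comment> \<open>Since \<open>P\<close> is at least \<mu>^2, half a power of \<mu> can be
      traded for \<open>P powr (1/4)\<close>, which leaves the decay exponent of the
      profile.\<close>
    have "\<mu> * (1 / P) \<le> sqrt \<mu> * P powr (-3/4)"
    proof -
      have "sqrt \<mu> = (\<mu>\<^sup>2) powr (1/4)" using \<mu>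
        by (simp add: powr_powr powr_half_sqrt flip: powr_numeral)
      also have "\<dots> \<le> P powr (1/4)" using \<mu> by (intro powr_mono2) (auto simp: P_def)
      finally have "sqrt \<mu> * (1 / P) \<le> P powr (1/4) * (1 / P)" using P0 by (intro mult_right_mono) auto
      also have "\<dots> = P powr (1/4 - 1)" using P0 by (subst powr_diff) simp
      finally have "sqrt \<mu> * (sqrt \<mu> * (1 / P)) \<le> sqrt \<mu> * P powr (-3/4)"
        using \<mu> by (intro mult_left_mono) auto
      moreover have "sqrt \<mu> * (sqrt \<mu> * (1 / P)) = \<mu> * (1 / P)" using \<mu> by (simp flip: mult.assoc)
      ultimately show ?thesis using \<mu> by simp
    qed
    then have \<mu>P: "(\<mu> / m) * (1 / P) \<le> (sqrt \<mu> / m) * P powr (-3/4)"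
      using m divide_right_mono[of "\<mu> * (1 / P)" "sqrt \<mu> * P powr (-3/4)" m] by (simp add: mult.commute)
    have "\<bar>D\<bar> = 3/4 * ((P / E) powr (-1/4) * \<bar>N / E\<^sup>2\<bar>)" by (simp add: D_def abs_mult)
    also have "\<dots> \<le> 3/4 * (c * (4 * (K\<^sup>2 + K) * c\<^sup>2 * (\<mu> / m) * (1 / P)))"
      using q N' c1 by (intro mult_left_mono mult_mono) auto
    also have "\<dots> = (3 * c^3 * (K\<^sup>2 + K)) * ((\<mu> / m) * (1 / P))"
      by (simp add: power2_eq_square power3_eq_cube algebra_simps add_divide_distrib)
    also have "\<dots> \<le> (3 * c^3 * (K\<^sup>2 + K)) * ((sqrt \<mu> / m) * P powr (-3/4))"
      using \<mu>P c1 assms by (intro mult_left_mono) auto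
    finally show ?thesis using der unfolding P_def by (auto simp: mult.assoc)
  qed
  moreover have "0 < 3 * c^3 * (K\<^sup>2 + K)" using c1 assms by (simp add: add_pos_pos)
  ultimately show thesis using that by blast
qed

section \<open>Sizes of the indices and the tiling of [0, 1]\<close>

definition block_size :: "int \<Rightarrow> int \<Rightarrow> real" where
  "block_size i j = 1 + \<bar>real_of_int i\<bar> + \<bar>real_of_int j\<bar>"

lemma block_size_ge_1: "block_size i j \<ge> 1"
  by (simp add: block_size_def)

lemma block_size_pos [simp]: "block_size i j > 0"
  using block_size_ge_1[of i j] by linarith

lemma block_size_neq_0 [simp]: "block_size i j \<noteq> 0"
  using block_size_pos[of i j] by linarith

lemma summable_on_int_powr:
  fixes \<gamma> :: real
  assumes "\<gamma> > 1"
  shows "(\<lambda>i::int. (1 + \<bar>real_of_int i\<bar>) powr -\<gamma>) summable_on UNIV"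
proof -
  let ?f = "\<lambda>i::int. (1 + \<bar>real_of_int i\<bar>) powr -\<gamma>"
  have s: "(\<lambda>n. (1 + real n) powr -\<gamma>) summable_on UNIV"
  proof (rule norm_summable_imp_summable_on)
    have "summable (\<lambda>n. real (Suc n) powr -\<gamma>)"
      using assms by (subst summable_Suc_iff) (simp add: summable_real_powr_iff)
    then show "summable (\<lambda>n. norm ((1 + real n) powr -\<gamma>))" by simp
  qed
  have "?f summable_on range int"
    using s by (subst summable_on_reindex) (auto simp: comp_def)
  moreover have "?f summable_on range (\<lambda>n. - int n)"
    using s by (subst summable_on_reindex) (auto simp: comp_def inj_on_def)
  then have "?f summable_on range (\<lambda>n. - int n) - range int"
    by (rule summable_on_subset_banach) auto
  ultimately have "?f summable_on range int \<union> (range (\<lambda>n. - int n) - range int)"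
    by (rule summable_on_Un_disjoint) auto
  moreover have "range int \<union> (range (\<lambda>n. - int n) - range int) = UNIV"
  proof -
    have "i \<in> range int \<or> i \<in> range (\<lambda>n. - int n)" for i :: int
      by (cases i rule: int_cases2) auto
    then show ?thesis by blast
  qed
  ultimately show ?thesis by simp
qed

text \<open>Rows indexed by \<open>i\<close> are laid end to end, each row is partitioned into cells
  indexed by \<open>j\<close>, and everything is divided by the total length \<open>S\<close>. Both
  series converge because \<beta>/2 > 1. Only 0, 1 and the ends of rows and cells stay
  uncovered.\<close>

lemma tiling_exists:
  fixes \<beta> :: real
  assumes \<beta>: "\<beta> > 2"
  obtains w pos where "w > 0"
    "\<And>i j i' j'. i < i' \<or> i = i' \<and> j < j' \<Longrightarrow> pos i j + w * block_size i j powr -\<beta> \<le> pos i' j'"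
    "\<And>i j. 0 \<le> pos i j" "\<And>i j. pos i j + w * block_size i j powr -\<beta> \<le> 1"
    "countable ({0..1} - (\<Union>i j. {pos i j<..<pos i j + w * block_size i j powr -\<beta>}))"
proof -
  define b where "b i = (1 + \<bar>real_of_int i\<bar>) powr -(\<beta>/2)" for i
  define a where "a i j = block_size i j powr -\<beta>" for i j
  have b_sum: "b summable_on UNIV" unfolding b_def by (rule summable_on_int_powr) (use \<beta> in simp)
  have b_pos: "b i > 0" for i by (simp add: b_def add_pos_nonneg)
  have a_pos: "a i j > 0" for i j using block_size_pos[of i j] by (simp add: a_def)
  \<comment> \<open>\<open>block_size i j\<close> dominates both 1 + |i| and 1 + |j|, so the
    exponent can be split evenly between them.\<close>
  have a_le: "a i j \<le> b i * b j" for i j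
  proof -
    have "(1 + \<bar>real_of_int i\<bar>) * (1 + \<bar>real_of_int j\<bar>) \<le> block_size i j * block_size i j"
      by (intro mult_mono) (auto simp: block_size_def)
    then have "(block_size i j * block_size i j) powr -(\<beta>/2)
        \<le> ((1 + \<bar>real_of_int i\<bar>) * (1 + \<bar>real_of_int j\<bar>)) powr -(\<beta>/2)"
      using \<beta> by (intro powr_mono2') (auto intro: mult_pos_pos)
    moreover have "(block_size i j * block_size i j) powr -(\<beta>/2) = a i j"
      by (simp add: a_def powr_mult less_imp_le flip: powr_add)
    ultimately show ?thesis by (simp add: b_def powr_mult)
  qed
  have a_sum: "a i summable_on UNIV" for i
    by (rule summable_on_comparison_test[OF summable_on_cmult_right[OF b_sum, of "b i"]])
      (auto simp: a_le a_pos less_imp_le)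
  define A where "A i = infsum (a i) UNIV" for i
  have "\<exists>v. (\<forall>j. v (j + 1) = v j + a i j) \<and> (\<forall>j k. j \<le> k \<longrightarrow> v j \<le> v k) \<and> (\<forall>j. 0 < v j) \<and> (\<forall>j. v j < A i)
      \<and> (\<forall>x. 0 < x \<longrightarrow> x < A i \<longrightarrow> (\<exists>j. v j \<le> x \<and> x < v (j + 1)))" for i
    unfolding A_def by (rule int_partition[OF a_pos a_sum, of i]) blast
  then obtain v where v: "v i (j + 1) = v i j + a i j" "j \<le> k \<Longrightarrow> v i j \<le> v i k" "0 < v i j" "v i j < A i"
    "0 < x \<Longrightarrow> x < A i \<Longrightarrow> \<exists>j. v i j \<le> x \<and> x < v i (j + 1)" for i j k x
    by metis
  have A_pos: "A i > 0" for i using v(3,4)[of i 0] by linarith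
  have A_le: "A i \<le> infsum b UNIV * b i" for i
  proof -
    have "A i \<le> infsum (\<lambda>j. b i * b j) UNIV"
      unfolding A_def by (intro infsum_mono a_sum summable_on_cmult_right b_sum a_le)
    then show ?thesis unfolding infsum_cmult_right' by (simp add: mult.commute)
  qed
  have A_sum: "A summable_on UNIV"
    by (rule summable_on_comparison_test[OF summable_on_cmult_right[OF b_sum, of "infsum b UNIV"]])
      (auto simp: A_le A_pos less_imp_le)
  define S where "S = infsum A UNIV"
  obtain u where u: "\<And>i. u (i + 1) = u i + A i" "\<And>i j. i \<le> j \<Longrightarrow> u i \<le> u j" "\<And>i. 0 < u i" "\<And>i. u i < S"
    "\<And>x. 0 < x \<Longrightarrow> x < S \<Longrightarrow> \<exists>i. u i \<le> x \<and> x < u (i + 1)"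
    unfolding S_def by (rule int_partition[OF A_pos A_sum]) blast
  have S: "S > 0" using u(3,4)[of 0] by linarith
  define pos where "pos i j = (u i + v i j) / S" for i j
  have nxt: "pos i j + 1 / S * block_size i j powr -\<beta> = (u i + v i (j + 1)) / S" for i j
    using v(1)[of i j] by (simp add: pos_def a_def add_divide_distrib)
  show thesis
  proof
    show "1 / S > 0" using S by simp
    show "0 \<le> pos i j" for i j using u(3)[of i] v(3)[of i j] S by (simp add: pos_def)
    show "pos i j + 1 / S * block_size i j powr -\<beta> \<le> 1" for i j
      unfolding nxt using u(1)[of i] u(4)[of "i + 1"] v(4)[of i "j + 1"] S by simp
    show "pos i j + 1 / S * block_size i j powr -\<beta> \<le> pos i' j'" if "i < i' \<or> i = i' \<and> j < j'" for i j i' j'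
    proof -
      have "u i + v i (j + 1) \<le> u i' + v i' j'"
        using that
      proof
        assume "i < i'"
        then show ?thesis
          using u(1)[of i] u(2)[of "i + 1" i'] v(4)[of i "j + 1"] v(3)[of i' j'] by simp
      qed (use v(2)[of "j + 1" j' i] in auto)
      then show ?thesis unfolding nxt unfolding pos_def using S by (intro divide_right_mono) auto
    qed
    \<comment> \<open>Locate \<open>x * S\<close> first in a row and then in a cell of that row; it
      can fail to be interior only at the left end of one of them.\<close>
    have "x \<in> {0, 1} \<union> range (\<lambda>i. u i / S) \<union> range (\<lambda>(i, j). pos i j)"
      if x: "x \<in> {0..1} - (\<Union>i j. {pos i j<..<pos i j + 1 / S * block_size i j powr -\<beta>})" for x
    proof (rule ccontr)
      assume n: "x \<notin> {0, 1} \<union> range (\<lambda>i. u i / S) \<union> range (\<lambda>(i, j). pos i j)"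
      have "0 < x" "x < 1" using x n by auto
      then have "0 < x * S" "x * S < S" using S by auto
      then obtain i where i: "u i \<le> x * S" "x * S < u (i + 1)" using u(5) by blast
      have "u i \<noteq> x * S"
      proof
        assume "u i = x * S"
        then have "x = u i / S" using S by simp
        then show False using n by blast
      qed
      then obtain j where j: "v i j \<le> x * S - u i" "x * S - u i < v i (j + 1)"
        using v(5)[of "x * S - u i" i] u(1)[of i] i by auto
      have "v i j \<noteq> x * S - u i"
      proof
        assume "v i j = x * S - u i"
        then have "x = pos i j" using S by (simp add: pos_def)
        then show False using n by blast
      qed
      then have "pos i j < x" using j(1) S by (simp add: pos_def field_simps)
      moreover have "x < pos i j + 1 / S * block_size i j powr -\<beta>"
        unfolding nxt using j(2) S by (simp add: field_simps)
      ultimately show False using x by auto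
    qed
    then show "countable ({0..1} - (\<Union>i j. {pos i j<..<pos i j + 1 / S * block_size i j powr -\<beta>}))"
      by (rule countable_subset[OF subsetI]) auto
  qed
qed

section \<open>Maps of the interval induced by lexicographically monotone maps\<close>

fun lex_less :: "int \<times> int \<times> real \<Rightarrow> int \<times> int \<times> real \<Rightarrow> bool" where
  "lex_less (i, j, s) (i', j', s') \<longleftrightarrow> i < i' \<or> i = i' \<and> (j < j' \<or> j = j' \<and> s < s')"

lemma lex_less_linear: "y = z \<or> lex_less y z \<or> lex_less z y"
  by (cases y; cases z) auto

definition lex_mono :: "(int \<times> int \<times> real \<Rightarrow> int \<times> int \<times> real) \<Rightarrow> bool" where
  "lex_mono \<phi> \<longleftrightarrow> (\<forall>y z. lex_less y z \<longrightarrow> lex_less (\<phi> y) (\<phi> z))"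

lemma lex_monoD: "lex_mono \<phi> \<Longrightarrow> lex_less y z \<Longrightarrow> lex_less (\<phi> y) (\<phi> z)"
  unfolding lex_mono_def by blast

lemma lex_mono_compose: "lex_mono \<phi> \<Longrightarrow> lex_mono \<xi> \<Longrightarrow> lex_mono (\<lambda>y. \<xi> (\<phi> y))"
  unfolding lex_mono_def by blast

fun shift :: "int \<Rightarrow> int \<Rightarrow> (int \<Rightarrow> int \<Rightarrow> real) \<Rightarrow> int \<times> int \<times> real \<Rightarrow> int \<times> int \<times> real" where
  "shift a f T (i, j, s) = (i + a, j + f, s + T i j)"

text \<open>The indices move by constants and all points of one line move by the same amount, so
  every comparison is preserved.\<close>

lemma lex_mono_shift: "lex_mono (shift a f T)"
  by (auto simp: lex_mono_def)

text \<open>The data supplied by \<open>profile_exists\<close>, and by \<open>tiling_exists\<close>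
  with \<beta> = 1/\<alpha>.\<close>

locale tiling =
  fixes \<alpha> c w :: real and G :: "real \<Rightarrow> real" and pos :: "int \<Rightarrow> int \<Rightarrow> real"
  assumes \<alpha>: "0 < \<alpha>" "\<alpha> < 1 / 2" and c: "c > 0" and w: "w > 0"
    and G_deriv: "\<And>s. (G has_real_derivative c * (1 + s\<^sup>2) powr (-3/4)) (at s)"
    and G_bot: "(G \<longlongrightarrow> 0) at_bot" and G_top: "(G \<longlongrightarrow> 1) at_top"
    and pos_step: "\<And>i j i' j'. i < i' \<or> i = i' \<and> j < j' \<Longrightarrow>
          pos i j + w * block_size i j powr -(1/\<alpha>) \<le> pos i' j'"
    and pos_ge_0: "\<And>i j. 0 \<le> pos i j"
    and pos_le_1: "\<And>i j. pos i j + w * block_size i j powr -(1/\<alpha>) \<le> 1"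
    and countable_gaps: "countable ({0..1} - (\<Union>i j. {pos i j<..<pos i j + w * block_size i j powr -(1/\<alpha>)}))"
begin

text \<open>Since \<open>len\<close> is proportional to \<open>scl\<^sup>-\<^sup>1\<^sup>/\<^sup>2\<close>, the derivative of \<open>s \<mapsto> pt (i, j, s)\<close> is asymptotically
  independent of \<open>(i, j)\<close> as \<open>s \<rightarrow> \<plusminus>\<infinity>\<close>.\<close>

definition len :: "int \<Rightarrow> int \<Rightarrow> real" where
  "len i j = w * block_size i j powr -(1/\<alpha>)"

definition scl :: "int \<Rightarrow> int \<Rightarrow> real" where
  "scl i j = block_size i j powr (2/\<alpha>)"

fun pt :: "int \<times> int \<times> real \<Rightarrow> real" where
  "pt (i, j, s) = pos i j + len i j * G (s / scl i j)"

declare pt.simps [simp del]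

lemmas pos_step' = pos_step[folded len_def]
  and pos_le_1' = pos_le_1[folded len_def]
  and countable_gaps' = countable_gaps[folded len_def]

lemma len_pos: "len i j > 0" using w block_size_pos[of i j] by (simp add: len_def)

lemma scl_pos: "scl i j > 0" using block_size_pos[of i j] by (simp add: scl_def)

lemma scl_neq_0 [simp]: "scl i j \<noteq> 0" using scl_pos[of i j] by simp

lemma G_less: "G s < G t" if "s < t"
proof (rule DERIV_pos_imp_increasing[OF that])
  fix x :: real
  have "1 + x\<^sup>2 > 0" by (simp add: add_pos_nonneg)
  then show "\<exists>y. (G has_real_derivative y) (at x) \<and> 0 < y"
    using G_deriv[of x] c by (intro exI[of _ "c * (1 + x\<^sup>2) powr (-3/4)"]) simp
qed

lemma G_bounds: "0 < G s" "G s < 1"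
proof -
  have "0 \<le> G (s - 1)"
  proof (rule tendsto_upperbound[OF G_bot])
    show "\<forall>\<^sub>F t in at_bot. G t \<le> G (s - 1)"
      using eventually_le_at_bot[of "s - 1"] by eventually_elim (metis G_less less_eq_real_def)
  qed simp
  then show "0 < G s" using G_less[of "s - 1" s] by simp
  have "G (s + 1) \<le> 1"
  proof (rule tendsto_lowerbound[OF G_top])
    show "\<forall>\<^sub>F t in at_top. G (s + 1) \<le> G t"
      using eventually_ge_at_top[of "s + 1"] by eventually_elim (metis G_less less_eq_real_def)
  qed simp
  then show "G s < 1" using G_less[of s "s + 1"] by simp
qed

lemma G_surj: assumes "0 < y" "y < 1" obtains s where "G s = y"
proof -
  obtain a where a: "G a < y"
    using order_tendstoD(2)[OF G_bot assms(1)] by (auto simp: eventually_at_bot_linorder)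
  obtain b where b: "y < G b"
    using order_tendstoD(1)[OF G_top assms(2)] by (auto simp: eventually_at_top_linorder)
  have "a \<le> b" using G_less[of b a] a b by (cases "a \<le> b") auto
  moreover have "continuous_on {a..b} G"
    using G_deriv by (intro DERIV_continuous_on) (auto intro: has_field_derivative_at_within)
  ultimately show thesis using IVT'[of G a y b] a b that by auto
qed

lemma pt_in_cell: "pos i j < pt (i, j, s)" "pt (i, j, s) < pos i j + len i j"
  using G_bounds[of "s / scl i j"] len_pos[of i j] by (simp_all add: pt.simps)

lemma pt_mono: "lex_less y z \<Longrightarrow> pt y < pt z"
proof (cases y, cases z)
  fix i j s i' j' s' assume "lex_less y z" and yz: "y = (i, j, s)" "z = (i', j', s')"
  then consider "i < i' \<or> i = i' \<and> j < j'" | "i = i'" "j = j'" "s < s'" by auto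
  then show "pt y < pt z"
  proof cases
    case 1
    then have "pos i j + len i j \<le> pos i' j'" by (rule pos_step')
    then show ?thesis
      unfolding yz using pt_in_cell(2)[of i j s] pt_in_cell(1)[of i' j' s'] by linarith
  next
    case 2
    then show ?thesis using yz G_less len_pos scl_pos by (simp add: pt.simps divide_strict_right_mono)
  qed
qed

lemma pt_less_iff: "pt y < pt z \<longleftrightarrow> lex_less y z"
  using pt_mono lex_less_linear by (metis less_asym less_irrefl)

lemma pt_eq_iff [simp]: "pt y = pt z \<longleftrightarrow> y = z"
  using pt_mono lex_less_linear by (metis less_irrefl)

lemma inj_pt: "inj pt" by (intro injI) simp

lemma pt_bounds: "0 < pt y" "pt y < 1"
proof -
  obtain i j s where "y = (i, j, s)" by (cases y)
  then show "0 < pt y" "pt y < 1"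
    using pt_in_cell[of i j s] pos_ge_0[of i j] pos_le_1'[of i j] by simp_all
qed

lemma cell_eq: "x \<in> {pos i j<..<pos i j + len i j} \<longleftrightarrow> (\<exists>s. x = pt (i, j, s))"
proof
  assume x: "x \<in> {pos i j<..<pos i j + len i j}"
  then have "0 < (x - pos i j) / len i j" "(x - pos i j) / len i j < 1"
    using len_pos[of i j] by (auto simp: field_simps)
  then obtain s where "G s = (x - pos i j) / len i j" by (rule G_surj)
  then have "x = pt (i, j, s * scl i j)"
    using len_pos[of i j] scl_pos[of i j] by (simp add: pt.simps field_simps)
  then show "\<exists>s. x = pt (i, j, s)" by blast
qed (use pt_in_cell in auto)

lemma range_pt: "range pt = (\<Union>i j. {pos i j<..<pos i j + len i j})"
  using cell_eq by (fastforce simp del: greaterThanLessThan_iff)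

lemma countable_complement: "countable ({0..1} - range pt)"
  unfolding range_pt by (rule countable_gaps')

text \<open>A nonempty open interval is uncountable, so it cannot lie inside the countable
  complement of the cells.\<close>

lemma pt_dense: assumes "0 \<le> a" "a < b" "b \<le> 1" obtains y where "a < pt y" "pt y < b"
proof -
  have "\<not> {a<..<b} \<subseteq> {0..1} - range pt"
    using countable_complement assms(2) by (metis countable_subset uncountable_open_interval)
  then obtain x where x: "x \<in> {a<..<b}" "x \<notin> {0..1} - range pt" by blast
  then have "x \<in> range pt" using assms by auto
  then show thesis using x(1) that by auto
qed

text \<open>Inserting 0 only matters for \<open>x \<le> 0\<close>, where it keeps the set nonempty.\<close>

definition induced :: "(int \<times> int \<times> real \<Rightarrow> int \<times> int \<times> real) \<Rightarrow> real \<Rightarrow> real" where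
  "induced \<phi> x = Sup (insert 0 ((\<lambda>y. pt (\<phi> y)) ` {y. pt y \<le> x}))"

lemma bdd_induced: "bdd_above (insert 0 ((\<lambda>y. pt (\<phi> y)) ` Y))"
  by (auto intro!: bdd_aboveI[of _ 1] intro: less_imp_le[OF pt_bounds(2)])

lemma induced_mono: "x \<le> x' \<Longrightarrow> induced \<phi> x \<le> induced \<phi> x'"
  unfolding induced_def by (intro cSup_subset_mono bdd_induced) auto

lemma induced_bounds: "0 \<le> induced \<phi> x" "induced \<phi> x \<le> 1"
proof -
  show "0 \<le> induced \<phi> x" unfolding induced_def by (intro cSup_upper bdd_induced) auto
  show "induced \<phi> x \<le> 1" unfolding induced_def
    by (intro cSup_least) (auto intro: less_imp_le[OF pt_bounds(2)])
qed

lemma induced_pt: assumes "lex_mono \<phi>" shows "induced \<phi> (pt y) = pt (\<phi> y)"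
  unfolding induced_def
proof (rule cSup_eq_maximum)
  fix x assume "x \<in> insert 0 ((\<lambda>y. pt (\<phi> y)) ` {y'. pt y' \<le> pt y})"
  then consider "x = 0" | z where "pt z \<le> pt y" "x = pt (\<phi> z)" by auto
  then show "x \<le> pt (\<phi> y)"
  proof cases
    case 2
    then have "z = y \<or> lex_less z y" by (metis lex_less_linear pt_less_iff not_less)
    then show ?thesis using 2 by (auto intro: less_imp_le pt_mono lex_monoD[OF assms])
  qed (use pt_bounds(1)[of "\<phi> y"] in simp)
qed auto

text \<open>Recognises the identity from the cells alone: if \<open>h\<close> moved
  \<open>x\<close>, a point of \<open>range pt\<close> strictly between \<open>x\<close> and
  \<open>h x\<close> would be fixed, against monotonicity.\<close>

lemma mono_fixing_pt_eq_id:
  assumes mono: "\<And>x y. x \<in> {0..1} \<Longrightarrow> y \<in> {0..1} \<Longrightarrow> x \<le> y \<Longrightarrow> h x \<le> h y"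
    and h01: "\<And>x. x \<in> {0..1} \<Longrightarrow> h x \<in> {0..1}"
    and fix_pt: "\<And>y. h (pt y) = pt y" and x: "x \<in> {0..1}"
  shows "h x = (x :: real)"
proof (cases x "h x" rule: linorder_cases)
  case less
  then obtain y where "x < pt y" "pt y < h x" using pt_dense[of x "h x"] x h01[OF x] by auto
  then show ?thesis using mono[of x "pt y"] x pt_bounds[of y] fix_pt[of y] by auto
next
  case greater
  then obtain y where "h x < pt y" "pt y < x" using pt_dense[of "h x" x] x h01[OF x] by auto
  then show ?thesis using mono[of "pt y" x] x pt_bounds[of y] fix_pt[of y] by auto
qed simp

section \<open>Inverses, composition and continuity of induced maps\<close>

lemma induced_inverse:
  assumes "lex_mono \<phi>" "lex_mono \<psi>" "\<And>y. \<psi> (\<phi> y) = y" "x \<in> {0..1}"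
  shows "induced \<psi> (induced \<phi> x) = x"
  by (rule mono_fixing_pt_eq_id[where h = "\<lambda>x. induced \<psi> (induced \<phi> x)", OF _ _ _ assms(4)])
    (auto intro: induced_mono simp: induced_pt induced_bounds assms(1-3))

text \<open>The criterion above compares a map only with the identity. Hence the inverse \<psi> of
  the composite is applied to the left side first, which recovers \<open>x\<close>; applying the map
  induced by the composite then cancels \<psi>.\<close>

lemma induced_compose:
  assumes mono: "lex_mono \<phi>" "lex_mono \<xi>" "lex_mono \<psi>"
    and inv: "\<And>y. \<psi> (\<xi> (\<phi> y)) = y" "\<And>y. \<xi> (\<phi> (\<psi> y)) = y" and x: "x \<in> {0..1}"
  shows "induced \<xi> (induced \<phi> x) = induced (\<lambda>y. \<xi> (\<phi> y)) x"
proof -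
  let ?\<omega> = "\<lambda>y. \<xi> (\<phi> y)"
  have \<omega>: "lex_mono ?\<omega>" using mono(1,2) by (rule lex_mono_compose)
  have "induced \<psi> (induced \<xi> (induced \<phi> x)) = x"
    by (rule mono_fixing_pt_eq_id[where h = "\<lambda>x. induced \<psi> (induced \<xi> (induced \<phi> x))", OF _ _ _ x])
      (auto intro: induced_mono simp: induced_pt induced_bounds mono inv)
  then have "induced ?\<omega> x = induced ?\<omega> (induced \<psi> (induced \<xi> (induced \<phi> x)))" by simp
  also have "\<dots> = induced \<xi> (induced \<phi> x)"
    using induced_bounds by (intro induced_inverse \<omega> mono inv) auto
  finally show ?thesis by simp
qed

lemma bij_betw_induced:
  assumes "lex_mono \<phi>" "lex_mono \<psi>" "\<And>y. \<psi> (\<phi> y) = y" "\<And>y. \<phi> (\<psi> y) = y"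
  shows "bij_betw (induced \<phi>) {0..1} {0..1}"
  by (rule bij_betw_byWitness[of _ "induced \<psi>"])
    (auto simp: induced_inverse assms induced_bounds)

lemma strict_mono_on_induced:
  assumes "lex_mono \<phi>" "lex_mono \<psi>" "\<And>y. \<psi> (\<phi> y) = y" "\<And>y. \<phi> (\<psi> y) = y"
  shows "strict_mono_on {0..1} (induced \<phi>)"
proof (rule strict_mono_onI)
  fix x y :: real assume xy: "x \<in> {0..1}" "y \<in> {0..1}" "x < y"
  then have "induced \<phi> x \<noteq> induced \<phi> y"
    using bij_betw_induced[OF assms] by (auto simp: bij_betw_def dest: inj_onD)
  then show "induced \<phi> x < induced \<phi> y" using induced_mono[of x y \<phi>] xy(3) by simp
qed

text \<open>Extended by the identity outside [0, 1], the map is a monotone surjection of the real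
  line, and such maps are continuous.\<close>

lemma continuous_on_induced:
  assumes "lex_mono \<phi>" "lex_mono \<psi>" "\<And>y. \<psi> (\<phi> y) = y" "\<And>y. \<phi> (\<psi> y) = y"
  shows "continuous_on {0..1} (induced \<phi>)"
proof -
  define F where "F x = (if x \<in> {0..1} then induced \<phi> x else x)" for x
  have "surj F"
  proof (rule surjI)
    show "F (if x \<in> {0..1} then induced \<psi> x else x) = x" for x
      using induced_inverse[OF assms(2,1,4), of x] induced_bounds[of \<psi> x] by (auto simp: F_def)
  qed
  moreover have "F x \<le> F y" if "x \<le> y" for x y
    using that induced_mono[OF that, of \<phi>] induced_bounds[of \<phi> x] induced_bounds[of \<phi> y]
    by (auto simp: F_def)
  ultimately have "continuous_on UNIV F" by (intro continuous_onI_mono) auto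
  then have "continuous_on {0..1} F" by (rule continuous_on_subset) simp
  then show ?thesis by (rule continuous_on_eq) (simp add: F_def)
qed

section \<open>Hoelder continuity of the derivative\<close>

text \<open>The derivative of the induced map at \<open>pt (i, j, s)\<close>: the ratio of the
  derivatives of \<open>pt\<close> at the image and at the source, in which the common factor
  \<open>w * c\<close> cancels.\<close>

definition shift_density :: "int \<Rightarrow> int \<Rightarrow> (int \<Rightarrow> int \<Rightarrow> real) \<Rightarrow> int \<Rightarrow> int \<Rightarrow> real \<Rightarrow> real" where
  "shift_density a f T i j s =
     (((scl i j)\<^sup>2 + s\<^sup>2) / ((scl (i + a) (j + f))\<^sup>2 + (s + T i j)\<^sup>2)) powr (3/4)"

text \<open>The value 1 off the cells is the limit of \<open>shift_density\<close> at both ends of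
  every line, which is what makes the function continuous.\<close>

definition slope :: "int \<Rightarrow> int \<Rightarrow> (int \<Rightarrow> int \<Rightarrow> real) \<Rightarrow> real \<Rightarrow> real" where
  "slope a f T x = (if x \<in> range pt then case inv_into UNIV pt x of (i, j, s) \<Rightarrow> shift_density a f T i j s else 1)"

lemma slope_pt: "slope a f T (pt (i, j, s)) = shift_density a f T i j s"
  by (simp add: slope_def inv_f_f[OF inj_pt])

text \<open>Both \<open>len\<close> and the inner derivative \<open>1 / scl\<close> are powers of
  the scale, with total exponent -3/2; as the square of the scale they are absorbed into the power
  -3/4.\<close>

lemma pt_deriv:
  "((\<lambda>s. pt (i, j, s)) has_real_derivative w * c * ((scl i j)\<^sup>2 + s\<^sup>2) powr (-3/4)) (at s)"
proof -
  let ?\<mu> = "scl i j"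
  have \<mu>: "?\<mu> > 0" by (rule scl_pos)
  have "((\<lambda>s. pt (i, j, s)) has_real_derivative
      len i j * (c * (1 + (s / ?\<mu>)\<^sup>2) powr (-3/4) * (1 / ?\<mu>))) (at s)"
    unfolding pt.simps using \<mu> by (auto intro!: derivative_eq_intros DERIV_chain2[OF G_deriv])
  moreover have "len i j * (c * (1 + (s / ?\<mu>)\<^sup>2) powr (-3/4) * (1 / ?\<mu>))
      = w * c * (?\<mu>\<^sup>2 + s\<^sup>2) powr (-3/4)"
  proof -
    have "len i j = w * ?\<mu> powr (-1/2)"
      by (simp add: len_def scl_def powr_powr)
    moreover have "?\<mu>\<^sup>2 + s\<^sup>2 = ?\<mu>\<^sup>2 * (1 + (s / ?\<mu>)\<^sup>2)"
      using \<mu> by (simp add: field_simps)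
    then have "(?\<mu>\<^sup>2 + s\<^sup>2) powr (-3/4) = (?\<mu>\<^sup>2) powr (-3/4) * (1 + (s / ?\<mu>)\<^sup>2) powr (-3/4)"
      by (simp add: powr_mult)
    moreover have "(?\<mu>\<^sup>2) powr (-3/4) = ?\<mu> powr (-1/2) * (1 / ?\<mu>)"
    proof -
      have "(?\<mu>\<^sup>2) powr (-3/4) = ?\<mu> powr (-1/2 - 1)"
        using \<mu> by (simp add: powr_powr flip: powr_numeral)
      also have "\<dots> = ?\<mu> powr (-1/2) * (1 / ?\<mu>)" using \<mu> by (subst powr_diff) simp
      finally show ?thesis .
    qed
    ultimately show ?thesis by simp
  qed
  ultimately show ?thesis by simp
qed

text \<open>In the coordinate \<open>s\<close> the map is a translation, so the inverse function
  rule for \<open>pt\<close> on the cell and the chain rule give the ratio of the two derivatives of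
  \<open>pt\<close>.\<close>

lemma induced_deriv:
  "(induced (shift a f T) has_real_derivative slope a f T (pt y)) (at (pt y))"
proof -
  obtain i j s where y: "y = (i, j, s)" by (cases y)
  let ?I = "{pos i j<..<pos i j + len i j}"
  \<comment> \<open>The coordinate \<open>s\<close> of a point of the cell.\<close>
  define g where "g x = snd (snd (inv_into UNIV pt x))" for x
  have g: "g (pt (i, j, t)) = t" for t by (simp add: g_def inv_f_f[OF inj_pt])
  define D where "D = w * c * ((scl i j)\<^sup>2 + s\<^sup>2) powr (-3/4)"
  define D' where "D' = w * c * ((scl (i + a) (j + f))\<^sup>2 + (s + T i j)\<^sup>2) powr (-3/4)"
  have P: "(scl i j)\<^sup>2 + s\<^sup>2 > 0" "(scl (i + a) (j + f))\<^sup>2 + (s + T i j)\<^sup>2 > 0"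
    using scl_pos[of i j] scl_pos[of "i + a" "j + f"] by (simp_all add: add_pos_nonneg)
  have "isCont (\<lambda>s. pt (i, j, s)) t" for t using pt_deriv by (rule DERIV_isCont)
  then have "isCont g (pt (i, j, s))"
    using isCont_inverse_function[of 1 s g "\<lambda>s. pt (i, j, s)"] g by simp
  then have "(g has_real_derivative inverse D) (at (pt (i, j, s)))"
  proof (rule DERIV_inverse_function[rotated 5])
    show "((\<lambda>s. pt (i, j, s)) has_real_derivative D) (at (g (pt (i, j, s))))"
      unfolding g D_def by (rule pt_deriv)
    show "D \<noteq> 0" using w c P(1) by (simp add: D_def)
    show "pos i j < pt (i, j, s)" "pt (i, j, s) < pos i j + len i j" by (rule pt_in_cell)+
    show "pt (i, j, g x) = x" if "pos i j < x" "x < pos i j + len i j" for x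
      using that cell_eq[of x i j] g by auto
  qed
  moreover have "((\<lambda>t. pt (i + a, j + f, t + T i j)) has_real_derivative D') (at (g (pt (i, j, s))))"
    unfolding g D'_def using DERIV_shift[THEN iffD1, OF pt_deriv] by blast
  ultimately have "((\<lambda>x. pt (i + a, j + f, g x + T i j)) has_real_derivative D' * inverse D) (at (pt (i, j, s)))"
    using DERIV_chain2 by blast
  then have "(induced (shift a f T) has_real_derivative D' * inverse D) (at (pt (i, j, s)))"
  proof (rule has_field_derivative_transform_within_open)
    show "pt (i + a, j + f, g x + T i j) = induced (shift a f T) x" if x: "x \<in> ?I" for x
    proof -
      obtain t where "x = pt (i, j, t)" using x cell_eq by blast
      then show ?thesis by (simp add: g induced_pt[OF lex_mono_shift])
    qed
  qed (use pt_in_cell in auto)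
  moreover have "D' * inverse D = slope a f T (pt (i, j, s))"
    using P w c by (simp add: D_def D'_def slope_pt shift_density_def powr_divide powr_minus field_simps)
  ultimately show ?thesis unfolding y by simp
qed

section \<open>Behaviour at the ends of a cell\<close>

lemma density_tendsto:
  "((\<lambda>s. shift_density a f T i j s) \<longlongrightarrow> 1) at_top" "((\<lambda>s. shift_density a f T i j s) \<longlongrightarrow> 1) at_bot"
proof -
  let ?q = "\<lambda>s. ((scl i j)\<^sup>2 + s\<^sup>2) / ((scl (i + a) (j + f))\<^sup>2 + (s + T i j)\<^sup>2)"
  have "(?q \<longlongrightarrow> 1) at_top" "(?q \<longlongrightarrow> 1) at_bot" by real_asymp+
  from this[THEN tendsto_powr[OF _ tendsto_const, of _ _ _ "3/4"]]
  show "((\<lambda>s. shift_density a f T i j s) \<longlongrightarrow> 1) at_top" "((\<lambda>s. shift_density a f T i j s) \<longlongrightarrow> 1) at_bot"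
    by (simp_all add: shift_density_def)
qed

lemma pt_tendsto:
  "((\<lambda>s. pt (i, j, s)) \<longlongrightarrow> pos i j + len i j) at_top" "((\<lambda>s. pt (i, j, s)) \<longlongrightarrow> pos i j) at_bot"
proof -
  have "filterlim (\<lambda>s. s / scl i j) at_top at_top" "filterlim (\<lambda>s. s / scl i j) at_bot at_bot"
    using scl_pos[of i j] by real_asymp+
  then have "((\<lambda>s. G (s / scl i j)) \<longlongrightarrow> 1) at_top" "((\<lambda>s. G (s / scl i j)) \<longlongrightarrow> 0) at_bot"
    using filterlim_compose[OF G_top] filterlim_compose[OF G_bot] by blast+
  then show "((\<lambda>s. pt (i, j, s)) \<longlongrightarrow> pos i j + len i j) at_top" "((\<lambda>s. pt (i, j, s)) \<longlongrightarrow> pos i j) at_bot"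
    unfolding pt.simps by (auto intro!: tendsto_eq_intros)
qed

end

text \<open>The bounds are the hypotheses of \<open>shift_ratio_deriv_bound\<close>, required in
  every cell with a single \<open>K\<close>.\<close>

locale tame_shift = tiling +
  fixes a f :: int and T :: "int \<Rightarrow> int \<Rightarrow> real" and K :: real
  assumes K: "K \<ge> 1"
    and scl_le: "\<And>i j. scl (i + a) (j + f) \<le> K * scl i j" "\<And>i j. scl i j \<le> K * scl (i + a) (j + f)"
    and scl_diff: "\<And>i j. \<bar>scl (i + a) (j + f) - scl i j\<bar> \<le> K * scl i j / block_size i j"
    and T_le: "\<And>i j. \<bar>T i j\<bar> \<le> K * scl i j / block_size i j"
begin

text \<open>Relative to \<open>pt\<close> the density has a Lipschitz constant of order
  \<open>sqrt (scl i j) / block_size i j\<close>. Distances within a cell are at most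
  \<open>len i j\<close>, so all but the \<alpha>-th power of a distance can be replaced by a power
  of \<open>len i j\<close>, and then the powers of \<open>block_size\<close> cancel.\<close>

lemma density_Holder:
  obtains C where "C > 0"
    "\<And>i j s t. \<bar>shift_density a f T i j s - shift_density a f T i j t\<bar> \<le> C * \<bar>pt (i, j, s) - pt (i, j, t)\<bar> powr \<alpha>"
proof -
  obtain C where C: "C > 0"
    and bound: "\<And>\<mu> \<mu>' T m s :: real. \<lbrakk>\<mu> > 0; \<mu>' > 0; m \<ge> 1; \<mu>' \<le> K * \<mu>; \<mu> \<le> K * \<mu>';
        \<bar>\<mu>' - \<mu>\<bar> \<le> K * \<mu> / m; \<bar>T\<bar> \<le> K * \<mu> / m\<rbrakk>
      \<Longrightarrow> \<exists>D. ((\<lambda>s. ((\<mu>\<^sup>2 + s\<^sup>2) / (\<mu>'\<^sup>2 + (s + T)\<^sup>2)) powr (3/4)) has_real_derivative D) (at s)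
        \<and> \<bar>D\<bar> \<le> C * (sqrt \<mu> / m) * (\<mu>\<^sup>2 + s\<^sup>2) powr (-3/4)"
    using shift_ratio_deriv_bound[OF K] by blast
  define C' where "C' = C / (w * c) * w powr (1 - \<alpha>)"
  have main: "\<bar>shift_density a f T i j s - shift_density a f T i j t\<bar> \<le> C' * \<bar>pt (i, j, s) - pt (i, j, t)\<bar> powr \<alpha>"
    if "s < t" for i j s t
  proof -
    let ?m = "block_size i j" and ?d = "shift_density a f T i j"
    define M where "M = C * (sqrt (scl i j) / ?m) / (w * c)"
    have D: "\<exists>D. (?d has_real_derivative D) (at x) \<and> \<bar>D\<bar> \<le> M * (w * c * ((scl i j)\<^sup>2 + x\<^sup>2) powr (-3/4))" for x
      using bound[OF scl_pos scl_pos block_size_ge_1 scl_le scl_diff T_le, of i j x] w c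
      unfolding shift_density_def M_def by (simp add: mult.assoc)
    \<comment> \<open>A mean value inequality with \<open>pt\<close> in place of the variable: the
      derivative of \<open>M * pt\<close> dominates that of \<open>?d\<close> in absolute value, and
      the two signs of \<sigma> give the two sides.\<close>
    have "M * pt (i, j, s) + \<sigma> * ?d s \<le> M * pt (i, j, t) + \<sigma> * ?d t" if "\<bar>\<sigma>\<bar> = 1" for \<sigma>
    proof (rule DERIV_nonneg_imp_nondecreasing[OF less_imp_le[OF \<open>s < t\<close>]])
      fix x
      obtain D where D: "(?d has_real_derivative D) (at x)"
        "\<bar>D\<bar> \<le> M * (w * c * ((scl i j)\<^sup>2 + x\<^sup>2) powr (-3/4))" using D by blast
      have "((\<lambda>s. M * pt (i, j, s) + \<sigma> * ?d s) has_real_derivative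
          M * (w * c * ((scl i j)\<^sup>2 + x\<^sup>2) powr (-3/4)) + \<sigma> * D) (at x)"
        by (auto intro!: derivative_eq_intros pt_deriv D(1))
      moreover have "\<bar>\<sigma> * D\<bar> = \<bar>D\<bar>" using that by (simp add: abs_mult)
      then have "M * (w * c * ((scl i j)\<^sup>2 + x\<^sup>2) powr (-3/4)) + \<sigma> * D \<ge> 0" using D(2) by linarith
      ultimately show "\<exists>y. ((\<lambda>s. M * pt (i, j, s) + \<sigma> * ?d s) has_real_derivative y) (at x) \<and> 0 \<le> y" by blast
    qed
    from this[of 1] this[of "-1"]
    have lip: "\<bar>?d s - ?d t\<bar> \<le> M * (pt (i, j, t) - pt (i, j, s))" by (simp add: algebra_simps)
    define \<delta> where "\<delta> = pt (i, j, t) - pt (i, j, s)"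
    have \<delta>: "0 < \<delta>" "\<delta> \<le> len i j"
      using pt_mono[of "(i, j, s)" "(i, j, t)"] that pt_in_cell[of i j s] pt_in_cell[of i j t] by (auto simp: \<delta>_def)
    have "M * \<delta> = M * \<delta> powr (1 - \<alpha>) * \<delta> powr \<alpha>" using \<delta> by (simp flip: powr_add)
    also have "\<dots> \<le> M * (len i j) powr (1 - \<alpha>) * \<delta> powr \<alpha>"
      using \<delta> \<alpha> C w c by (intro mult_right_mono mult_left_mono powr_mono2) (auto simp: M_def less_imp_le scl_pos)
    \<comment> \<open>The exponents of \<open>block_size\<close> are 1/\<alpha> from the square
      root, -1 from the division and 1 - 1/\<alpha> from the length; they add up to 0.\<close>
    also have "M * (len i j) powr (1 - \<alpha>) = C'"
    proof -
      have "sqrt (scl i j) = ?m powr (1 / \<alpha>)"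
        by (simp add: scl_def powr_powr flip: powr_half_sqrt)
      moreover have "(len i j) powr (1 - \<alpha>) = w powr (1 - \<alpha>) * ?m powr (1 - 1 / \<alpha>)"
      proof -
        have "-(1 / \<alpha>) * (1 - \<alpha>) = 1 - 1 / \<alpha>" using \<alpha> by (simp add: field_simps)
        then show ?thesis unfolding len_def powr_mult powr_powr by (simp only:)
      qed
      moreover have "?m powr (1 / \<alpha>) / ?m * ?m powr (1 - 1 / \<alpha>) = 1"
        by (simp add: powr_diff less_imp_le)
      ultimately show ?thesis unfolding M_def C'_def by (simp add: field_simps)
    qed
    finally show ?thesis using lip \<delta> by (simp add: \<delta>_def abs_minus_commute)
  qed
  show thesis
  proof
    show "C' > 0" using C w c by (simp add: C'_def)
    show "\<bar>shift_density a f T i j s - shift_density a f T i j t\<bar> \<le> C' * \<bar>pt (i, j, s) - pt (i, j, t)\<bar> powr \<alpha>" for i j s t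
      by (cases s t rule: linorder_cases) (auto dest: main[of _ _ i j] simp: abs_minus_commute)
  qed
qed

text \<open>Two points of one cell are covered by \<open>density_Holder\<close>. Otherwise each
  point is compared with the value 1, which is attained no farther away than the other point, and
  the triangle inequality doubles the constant.\<close>

lemma Holder_slope: "Holder_on \<alpha> {0..1} (slope a f T)"
proof -
  obtain C where C: "C > 0" and Hol: "\<And>i j s t. \<bar>shift_density a f T i j s - shift_density a f T i j t\<bar>
      \<le> C * \<bar>pt (i, j, s) - pt (i, j, t)\<bar> powr \<alpha>"
    using density_Holder by blast
  \<comment> \<open>The estimate inside a cell passes to the limit as \<open>t\<close> runs to an
    end of the line; \<open>pt (i, j, s) \<noteq> e\<close> keeps the base of the power away from 0
    in the limit.\<close>
  have edge: "\<bar>shift_density a f T i j s - 1\<bar> \<le> C * \<bar>pt (i, j, s) - e\<bar> powr \<alpha>"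
    if "F \<noteq> bot" "(shift_density a f T i j \<longlongrightarrow> 1) F" "((\<lambda>t. pt (i, j, t)) \<longlongrightarrow> e) F" "pt (i, j, s) \<noteq> e" for i j s e F
  proof (rule tendsto_le[OF that(1)])
    show "((\<lambda>t. \<bar>shift_density a f T i j s - shift_density a f T i j t\<bar>) \<longlongrightarrow> \<bar>shift_density a f T i j s - 1\<bar>) F"
      by (intro tendsto_intros that)
    show "((\<lambda>t. C * \<bar>pt (i, j, s) - pt (i, j, t)\<bar> powr \<alpha>) \<longlongrightarrow> C * \<bar>pt (i, j, s) - e\<bar> powr \<alpha>) F"
      using that(4) by (intro tendsto_intros that) auto
  qed (use Hol in auto)
  have far: "\<bar>slope a f T x - 1\<bar> \<le> C * \<bar>x - z\<bar> powr \<alpha>"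
    if sep: "\<And>i j s t. x = pt (i, j, s) \<Longrightarrow> z \<noteq> pt (i, j, t)" for x z
  proof (cases "x \<in> range pt")
    case True
    then obtain i j s where x: "x = pt (i, j, s)" by (metis prod_cases3 rangeE)
    have "\<bar>shift_density a f T i j s - 1\<bar> \<le> C * \<bar>x - e\<bar> powr \<alpha>" if "e = pos i j \<or> e = pos i j + len i j" for e
      using that pt_in_cell[of i j s]
        edge[where F = at_bot and i = i and j = j and s = s, OF _ density_tendsto(2) pt_tendsto(2)]
        edge[where F = at_top and i = i and j = j and s = s, OF _ density_tendsto(1) pt_tendsto(1)]
      unfolding x by auto
    \<comment> \<open>Going from \<open>x\<close> to a point \<open>z\<close> outside the cell means
      reaching one of its ends, which is therefore at most as far from \<open>x\<close> as
      \<open>z\<close> is.\<close>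
    moreover have "\<exists>e. (e = pos i j \<or> e = pos i j + len i j) \<and> \<bar>x - e\<bar> \<le> \<bar>x - z\<bar>"
    proof -
      have "z \<notin> {pos i j<..<pos i j + len i j}" unfolding cell_eq using sep x by blast
      then show ?thesis using pt_in_cell[of i j s] x by force
    qed
    ultimately obtain e where "\<bar>shift_density a f T i j s - 1\<bar> \<le> C * \<bar>x - e\<bar> powr \<alpha>" "\<bar>x - e\<bar> \<le> \<bar>x - z\<bar>" by blast
    moreover from this(2) have "\<bar>x - e\<bar> powr \<alpha> \<le> \<bar>x - z\<bar> powr \<alpha>" using \<alpha> by (intro powr_mono2) auto
    ultimately show ?thesis using C unfolding x slope_pt by (meson mult_left_mono order_trans less_imp_le)
  qed (use C in \<open>simp add: slope_def\<close>)
  show ?thesis unfolding Holder_on_def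
  proof (intro exI conjI ballI)
    show "2 * C > 0" using C by simp
    fix x y
    show "\<bar>slope a f T x - slope a f T y\<bar> \<le> 2 * C * \<bar>x - y\<bar> powr \<alpha>"
    proof (cases "\<exists>i j s t. x = pt (i, j, s) \<and> y = pt (i, j, t)")
      case True
      then obtain i j s t where "x = pt (i, j, s)" "y = pt (i, j, t)" by blast
      then have "\<bar>slope a f T x - slope a f T y\<bar> \<le> C * \<bar>x - y\<bar> powr \<alpha>" using Hol by (simp add: slope_pt)
      also have "\<dots> \<le> 2 * C * \<bar>x - y\<bar> powr \<alpha>" using C by simp
      finally show ?thesis .
    next
      case False
      then have "\<bar>slope a f T x - 1\<bar> \<le> C * \<bar>x - y\<bar> powr \<alpha>" "\<bar>slope a f T y - 1\<bar> \<le> C * \<bar>y - x\<bar> powr \<alpha>"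
        by (blast intro!: far)+
      then show ?thesis by (simp add: abs_minus_commute)
    qed
  qed
qed

end

section \<open>The action of the matrix group\<close>

lemma unitriangular_4_mult_entries:
  assumes "A \<in> lower_unitriangular_mats 4" "B \<in> lower_unitriangular_mats 4"
  shows "(A * B) $$ (1,0) = A $$ (1,0) + B $$ (1,0)"
    "(A * B) $$ (2,1) = A $$ (2,1) + B $$ (2,1)"
    "(A * B) $$ (3,2) = A $$ (3,2) + B $$ (3,2)"
    "(A * B) $$ (2,0) = A $$ (2,0) + A $$ (2,1) * B $$ (1,0) + B $$ (2,0)"
    "(A * B) $$ (3,1) = A $$ (3,1) + A $$ (3,2) * B $$ (2,1) + B $$ (3,1)"
    "(A * B) $$ (3,0) = A $$ (3,0) + A $$ (3,1) * B $$ (1,0) + A $$ (3,2) * B $$ (2,0) + B $$ (3,0)"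
proof -
  have c: "A \<in> carrier_mat 4 4" "B \<in> carrier_mat 4 4"
    and z: "\<And>i j. i < 4 \<Longrightarrow> j < 4 \<Longrightarrow> i < j \<Longrightarrow> A $$ (i, j) = 0 \<and> B $$ (i, j) = 0"
    and d: "\<And>i. i < 4 \<Longrightarrow> A $$ (i, i) = 1 \<and> B $$ (i, i) = 1"
    using assms by (auto simp: lower_unitriangular_mats_def)
  have "{0..<4} = {0, 1, 2, 3::nat}" by auto
  then have e: "(A * B) $$ (i, j) = A $$ (i, 0) * B $$ (0, j) + A $$ (i, 1) * B $$ (1, j)
      + A $$ (i, 2) * B $$ (2, j) + A $$ (i, 3) * B $$ (3, j)" if "i < 4" "j < 4" for i j
    using that c by (simp add: scalar_prod_def)
  show "(A * B) $$ (1,0) = A $$ (1,0) + B $$ (1,0)"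
    using e[of 1 0] z[of 1 2] z[of 1 3] d[of 0] d[of 1] by simp
  show "(A * B) $$ (2,1) = A $$ (2,1) + B $$ (2,1)"
    using e[of 2 1] z[of 0 1] z[of 2 3] d[of 1] d[of 2] by simp
  show "(A * B) $$ (3,2) = A $$ (3,2) + B $$ (3,2)"
    using e[of 3 2] z[of 0 2] z[of 1 2] d[of 2] d[of 3] by simp
  show "(A * B) $$ (2,0) = A $$ (2,0) + A $$ (2,1) * B $$ (1,0) + B $$ (2,0)"
    using e[of 2 0] z[of 2 3] d[of 0] d[of 2] by simp
  show "(A * B) $$ (3,1) = A $$ (3,1) + A $$ (3,2) * B $$ (2,1) + B $$ (3,1)"
    using e[of 3 1] z[of 0 1] d[of 1] d[of 3] by simp
  show "(A * B) $$ (3,0) = A $$ (3,0) + A $$ (3,1) * B $$ (1,0) + A $$ (3,2) * B $$ (2,0) + B $$ (3,0)"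
    using e[of 3 0] d[of 0] d[of 3] by simp
qed

lemma unitriangular_4_eqI:
  assumes "A \<in> lower_unitriangular_mats 4" "B \<in> lower_unitriangular_mats 4"
    "A $$ (1,0) = B $$ (1,0)" "A $$ (2,0) = B $$ (2,0)" "A $$ (2,1) = B $$ (2,1)"
    "A $$ (3,0) = B $$ (3,0)" "A $$ (3,1) = B $$ (3,1)" "A $$ (3,2) = B $$ (3,2)"
  shows "A = B"
proof (rule eq_matI)
  have lt4: "i < 4 \<longleftrightarrow> i = 0 \<or> i = 1 \<or> i = 2 \<or> i = 3" for i :: nat by auto
  fix i j assume "i < dim_row B" "j < dim_col B"
  then have ij: "i < 4" "j < 4" using assms(2) by (auto simp: lower_unitriangular_mats_def)
  show "A $$ (i, j) = B $$ (i, j)"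
  proof (cases i j rule: linorder_cases)
    case greater
    then show ?thesis using ij assms(3-) unfolding lt4 by auto
  qed (use ij assms(1,2) in \<open>auto simp: lower_unitriangular_mats_def\<close>)
qed (use assms(1,2) in \<open>auto simp: lower_unitriangular_mats_def\<close>)

text \<open>Under left multiplication of \<open>h\<close> by \<open>A\<close>, the quantity \<open>h\<^sub>3\<^sub>0 - h\<^sub>3\<^sub>2 h\<^sub>2\<^sub>0\<close> increases by an amount that
  depends on \<open>h\<close> only through \<open>i = h\<^sub>1\<^sub>0\<close> and \<open>j = h\<^sub>3\<^sub>2\<close>. This amount is the cocycle below.\<close>

definition translation :: "int mat \<Rightarrow> int \<Rightarrow> int \<Rightarrow> real" where
  "translation A i j = of_int (A $$ (3,0) + A $$ (3,1) * i - (A $$ (3,2) + j) * (A $$ (2,0) + A $$ (2,1) * i))"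

text \<open>Left multiplication on the integer triples \<open>(h10, h32, h30 - h32 * h20)\<close>,
  extended to real third coordinates.\<close>

definition act :: "int mat \<Rightarrow> int \<times> int \<times> real \<Rightarrow> int \<times> int \<times> real" where
  "act A = shift (A $$ (1,0)) (A $$ (3,2)) (translation A)"

lemma act_mult:
  assumes "A \<in> lower_unitriangular_mats 4" "B \<in> lower_unitriangular_mats 4"
  shows "act (A * B) y = act A (act B y)"
proof -
  obtain i j s where y: "y = (i, j, s)" by (cases y)
  \<comment> \<open>The cocycle rule: \<open>A\<close> is evaluated at the indices already moved by
    \<open>B\<close>.\<close>
  have "translation (A * B) i j = translation A (i + B $$ (1,0)) (j + B $$ (3,2)) + translation B i j"
    unfolding translation_def unitriangular_4_mult_entries[OF assms] of_int_add[symmetric] of_int_eq_iff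
    by (simp add: algebra_simps)
  then show ?thesis unfolding y act_def shift.simps unitriangular_4_mult_entries[OF assms] by simp
qed

lemma act_one: "act (1\<^sub>m 4) y = y"
  by (cases y) (simp add: act_def translation_def)

lemma act_inject:
  assumes A: "A \<in> lower_unitriangular_mats 4" and B: "B \<in> lower_unitriangular_mats 4"
    and eq: "\<And>y. act A y = act B y"
  shows "A = B"
proof -
  have *: "A $$ (1,0) = B $$ (1,0)" "A $$ (3,2) = B $$ (3,2)" "translation A i j = translation B i j" for i j
    using eq[of "(i, j, 0)"] by (simp_all add: act_def)
  define f where "f = B $$ (3,2)"
  have T: "A $$ (3,0) + A $$ (3,1) * i - (f + j) * (A $$ (2,0) + A $$ (2,1) * i)
      = B $$ (3,0) + B $$ (3,1) * i - (f + j) * (B $$ (2,0) + B $$ (2,1) * i)" for i j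
    using *(3)[of i j] unfolding translation_def *(2) of_int_eq_iff f_def .
  \<comment> \<open>At \<open>j = - f\<close> the product term vanishes, and at
    \<open>j = 1 - f\<close> its first factor is 1; with \<open>i\<close> equal to 0 or 1 this
    isolates the four entries one after the other.\<close>
  have 1: "A $$ (3,0) = B $$ (3,0)" using T[of 0 "- f"] by simp
  have 2: "A $$ (3,1) = B $$ (3,1)" using T[of 1 "- f"] 1 by simp
  have 3: "A $$ (2,0) = B $$ (2,0)" using T[of 0 "1 - f"] 1 by simp
  have 4: "A $$ (2,1) = B $$ (2,1)" using T[of 1 "1 - f"] 1 2 3 by simp
  show ?thesis by (rule unitriangular_4_eqI[OF A B]) (use * 1 2 3 4 in auto)
qed

section \<open>Growth estimates for the action and regularity of the induced maps\<close>

lemma Holder_on_imp_continuous_on: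
  assumes "Holder_on \<alpha> S g" "\<alpha> > 0"
  shows "continuous_on S g"
proof -
  obtain C where C: "\<And>x y. x \<in> S \<Longrightarrow> y \<in> S \<Longrightarrow> \<bar>g x - g y\<bar> \<le> C * \<bar>x - y\<bar> powr \<alpha>"
    using assms(1) unfolding Holder_on_def by blast
  have "(g \<longlongrightarrow> g x) (at x within S)" if x: "x \<in> S" for x
  proof -
    have "((\<lambda>y. \<bar>y - x\<bar>) \<longlongrightarrow> 0) (at x within S)"
      by (auto intro!: tendsto_eq_intros)
    then have "((\<lambda>y. \<bar>y - x\<bar> powr \<alpha>) \<longlongrightarrow> 0) (at x within S)"
      by (rule tendsto_zero_powrI[OF _ tendsto_const]) (use assms(2) in auto)
    then have lim: "((\<lambda>y. C * \<bar>y - x\<bar> powr \<alpha>) \<longlongrightarrow> 0) (at x within S)"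
      by (rule tendsto_mult_right_zero)
    have "((\<lambda>y. g y - g x) \<longlongrightarrow> 0) (at x within S)"
    proof (rule Lim_null_comparison[OF _ lim])
      show "\<forall>\<^sub>F y in at x within S. norm (g y - g x) \<le> C * \<bar>y - x\<bar> powr \<alpha>"
        using C x by (simp add: eventually_at_filter)
    qed
    then show ?thesis by (rule LIM_zero_cancel)
  qed
  then show ?thesis by (simp add: continuous_on_def)
qed

lemma powr_diff_le:
  fixes x y z \<gamma> :: real
  assumes "0 < x" "x \<le> z" "0 < y" "y \<le> z" "1 \<le> \<gamma>"
  shows "\<bar>x powr \<gamma> - y powr \<gamma>\<bar> \<le> \<gamma> * z powr (\<gamma> - 1) * \<bar>x - y\<bar>"
proof -
  have "norm (x powr \<gamma> - y powr \<gamma>) \<le> \<gamma> * z powr (\<gamma> - 1) * norm (x - y)"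
  proof (rule field_differentiable_bound[of "{0<..z}"])
    fix t assume t: "t \<in> {0<..z}"
    show "((\<lambda>x. x powr \<gamma>) has_field_derivative \<gamma> * t powr (\<gamma> - 1)) (at t within {0<..z})"
      using t by (auto intro!: derivative_eq_intros)
    show "norm (\<gamma> * t powr (\<gamma> - 1)) \<le> \<gamma> * z powr (\<gamma> - 1)"
      using t assms(5) by (auto simp: abs_mult intro!: mult_left_mono powr_mono2)
  qed (use assms in auto)
  then show ?thesis by simp
qed

context tiling
begin

text \<open>A shift changes the size of the index by a bounded amount, so by the mean value bound
  for powers the scale changes by a relative amount of order \<open>1 / block_size\<close>.
  Quadratic growth of \<open>T\<close> is admissible because the permitted bound grows with exponent
  \<gamma> - 1, which is at least 3.\<close>

lemma tame_shift_exists: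
  assumes T: "\<And>i j. \<bar>T i j\<bar> \<le> M * (block_size i j)\<^sup>2"
  obtains K where "tame_shift \<alpha> c w G pos a f T K"
proof -
  define k where "k = 1 + \<bar>real_of_int a\<bar> + \<bar>real_of_int f\<bar>"
  define \<gamma> where "\<gamma> = 2 / \<alpha>"
  have k: "k \<ge> 1" by (simp add: k_def)
  have \<gamma>: "\<gamma> \<ge> 4" using \<alpha> by (simp add: \<gamma>_def field_simps)
  \<comment> \<open>The first summand serves the three bounds on the scales, the second the bound on
    \<open>T\<close>.\<close>
  define K where "K = \<gamma> * k powr \<gamma> + \<bar>M\<bar>"
  have k\<gamma>: "1 \<le> k powr \<gamma>" using k \<gamma> by (intro ge_one_powr_ge_zero) auto
  have kK: "k powr \<gamma> \<le> K"
    using mult_right_mono[of 1 \<gamma> "k powr \<gamma>"] \<gamma> k\<gamma> unfolding K_def by linarith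
  \<comment> \<open>Turns an additive change by \<open>k - 1\<close> into a factor \<open>k\<close>;
    sizes of indices are at least 1.\<close>
  have grow: "x + (k - 1) \<le> k * x" if "x \<ge> 1" for x
  proof -
    have "(k - 1) * 1 \<le> (k - 1) * x" using k that by (intro mult_left_mono) auto
    then show ?thesis by (simp add: algebra_simps)
  qed
  have near: "\<bar>block_size (i + a) (j + f) - block_size i j\<bar> \<le> k - 1" for i j
    unfolding block_size_def k_def of_int_add by linarith
  have bs: "block_size (i + a) (j + f) \<le> k * block_size i j" "block_size i j \<le> k * block_size (i + a) (j + f)" for i j
    using near[of i j] grow[OF block_size_ge_1[of i j]] grow[OF block_size_ge_1[of "i + a" "j + f"]] by linarith+
  have scl_bs: "scl i j = block_size i j powr \<gamma>" for i j by (simp add: scl_def \<gamma>_def)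
  have scl_div: "scl i j / block_size i j = block_size i j powr (\<gamma> - 1)" for i j
    by (simp add: scl_bs powr_diff less_imp_le)
  have powr_bs: "x powr \<gamma> \<le> K * y powr \<gamma>" if "0 < x" "0 < y" "x \<le> k * y" for x y
  proof -
    have "x powr \<gamma> \<le> (k * y) powr \<gamma>" using that \<gamma> by (intro powr_mono2) auto
    also have "\<dots> = k powr \<gamma> * y powr \<gamma>" using that k by (simp add: powr_mult)
    also have "\<dots> \<le> K * y powr \<gamma>" using kK by (intro mult_right_mono) auto
    finally show ?thesis .
  qed
  have "tame_shift \<alpha> c w G pos a f T K"
  proof unfold_locales
    show "1 \<le> K" using kK k\<gamma> by linarith
    show "scl (i + a) (j + f) \<le> K * scl i j" "scl i j \<le> K * scl (i + a) (j + f)" for i j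
      unfolding scl_bs by (intro powr_bs bs block_size_pos)+
    show "\<bar>scl (i + a) (j + f) - scl i j\<bar> \<le> K * scl i j / block_size i j" for i j
    proof -
      let ?m = "block_size i j"
      have "?m \<le> k * ?m" using mult_right_mono[OF k, of ?m] by (simp add: less_imp_le)
      then have "\<bar>scl (i + a) (j + f) - scl i j\<bar>
          \<le> \<gamma> * (k * ?m) powr (\<gamma> - 1) * \<bar>block_size (i + a) (j + f) - ?m\<bar>"
        unfolding scl_bs using bs \<gamma> by (intro powr_diff_le) auto
      also have "\<dots> \<le> \<gamma> * (k * ?m) powr (\<gamma> - 1) * k"
        using near[of i j] \<gamma> by (intro mult_left_mono) auto
      also have "\<dots> = \<gamma> * k powr \<gamma> * ?m powr (\<gamma> - 1)"
        using k powr_mult_base[of k "\<gamma> - 1"] by (simp add: powr_mult mult.commute)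
      also have "\<dots> \<le> K * ?m powr (\<gamma> - 1)" by (intro mult_right_mono) (auto simp: K_def)
      finally show ?thesis by (simp flip: scl_div)
    qed
    show "\<bar>T i j\<bar> \<le> K * scl i j / block_size i j" for i j
    proof -
      have "(block_size i j)\<^sup>2 = block_size i j powr 2" by (simp add: less_imp_le)
      also have "\<dots> \<le> block_size i j powr (\<gamma> - 1)" using \<gamma> block_size_ge_1 by (intro powr_mono) auto
      finally have "\<bar>M\<bar> * (block_size i j)\<^sup>2 \<le> K * block_size i j powr (\<gamma> - 1)"
        using \<gamma> by (intro mult_mono) (auto simp: K_def)
      moreover have "M * (block_size i j)\<^sup>2 \<le> \<bar>M\<bar> * (block_size i j)\<^sup>2"
        by (intro mult_right_mono) auto
      ultimately have "M * (block_size i j)\<^sup>2 \<le> K * block_size i j powr (\<gamma> - 1)" by linarith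
      then show ?thesis using T[of i j] by (simp flip: scl_div)
    qed
  qed
  then show thesis by (rule that)
qed

end

text \<open>Inside the cells \<open>induced_deriv\<close> applies. The rest of the interval is
  countable and \<open>slope\<close> is continuous, so the derivative extends to all points,
  including 0 and 1.\<close>

lemma (in tame_shift) induced_has_derivative:
  assumes x: "x \<in> {0..1}"
  shows "(induced (shift a f T) has_real_derivative slope a f T x) (at x within {0..1})"
proof (rule has_derivative_if_off_countable[OF _ _ countable_complement _ x])
  show "continuous_on {0..1} (slope a f T)"
    using Holder_slope \<alpha>(1) by (rule Holder_on_imp_continuous_on)
  show "continuous_on {0..1} (induced (shift a f T))"
  proof (rule continuous_on_induced[OF lex_mono_shift lex_mono_shift])
    \<comment> \<open>The inverse has to undo the translation of the line it returns to, hence the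
      indices moved back in \<open>T\<close>.\<close>
    show "shift (- a) (- f) (\<lambda>i j. - T (i - a) (j - f)) (shift a f T y) = y"
      "shift a f T (shift (- a) (- f) (\<lambda>i j. - T (i - a) (j - f)) y) = y" for y
      by (cases y; simp)+
  qed
  show "(induced (shift a f T) has_real_derivative slope a f T x) (at x)"
    if "x \<in> {0<..<1} - ({0..1} - range pt)" for x
    using that induced_deriv by auto
qed

text \<open>The cocycle is an affine function of \<open>i\<close> minus a product of affine
  functions of \<open>j\<close> and of \<open>i\<close>, and each of these is at most a constant
  times \<open>block_size\<close>.\<close>

lemma translation_bound: "\<exists>M. \<forall>i j. \<bar>translation A i j\<bar> \<le> M * (block_size i j)\<^sup>2"
proof (intro exI allI)
  fix i j
  let ?a = "\<lambda>k l. \<bar>real_of_int (A $$ (k, l))\<bar>" and ?m = "block_size i j"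
  have m: "1 \<le> ?m" "\<bar>real_of_int i\<bar> \<le> ?m" "\<bar>real_of_int j\<bar> \<le> ?m" by (simp_all add: block_size_def)
  have lin: "p + q * t \<le> (p + q) * ?m" if "0 \<le> p" "0 \<le> q" "t \<le> ?m" for p q t
    using mult_left_mono[OF m(1), of p] mult_left_mono[of t ?m q] that by (simp add: algebra_simps)
  have l: "\<bar>p + q * t\<bar> \<le> (\<bar>p\<bar> + \<bar>q\<bar>) * ?m" if "\<bar>t\<bar> \<le> ?m" for p q t
    using lin[of "\<bar>p\<bar>" "\<bar>q\<bar>" "\<bar>t\<bar>"] that abs_triangle_ineq[of p "q * t"] by (simp add: abs_mult)
  define u where "u = real_of_int (A $$ (3,0)) + real_of_int (A $$ (3,1)) * real_of_int i"
  \<comment> \<open>The factor 1 gives \<open>v\<close> the shape to which \<open>l\<close>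
    applies.\<close>
  define v where "v = real_of_int (A $$ (3,2)) + 1 * real_of_int j"
  define r where "r = real_of_int (A $$ (2,0)) + real_of_int (A $$ (2,1)) * real_of_int i"
  have "\<bar>u\<bar> \<le> (?a 3 0 + ?a 3 1) * ?m" unfolding u_def by (rule l) (rule m)
  also have "\<dots> \<le> (?a 3 0 + ?a 3 1) * ?m\<^sup>2"
    using m(1) by (intro mult_left_mono self_le_power) auto
  finally have u: "\<bar>u\<bar> \<le> (?a 3 0 + ?a 3 1) * ?m\<^sup>2" .
  have "\<bar>v\<bar> \<le> (?a 3 2 + \<bar>1\<bar>) * ?m" unfolding v_def by (rule l) (rule m)
  moreover have "\<bar>r\<bar> \<le> (?a 2 0 + ?a 2 1) * ?m" unfolding r_def by (rule l) (rule m)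
  ultimately have "\<bar>v\<bar> * \<bar>r\<bar> \<le> (?a 3 2 + \<bar>1\<bar>) * ?m * ((?a 2 0 + ?a 2 1) * ?m)"
    by (intro mult_mono) (auto simp: less_imp_le)
  moreover have "translation A i j = u - v * r"
    by (simp add: translation_def u_def v_def r_def)
  then have "\<bar>translation A i j\<bar> \<le> \<bar>u\<bar> + \<bar>v\<bar> * \<bar>r\<bar>"
    by (simp add: abs_mult[symmetric] abs_triangle_ineq4)
  ultimately show "\<bar>translation A i j\<bar>
      \<le> (?a 3 0 + ?a 3 1 + (?a 3 2 + 1) * (?a 2 0 + ?a 2 1)) * ?m\<^sup>2"
    using u by (simp add: algebra_simps power2_eq_square)
qed

context tiling
begin

lemma act_derivative:
  obtains D where "\<And>x. x \<in> {0..1} \<Longrightarrow> (induced (act A) has_real_derivative D x) (at x within {0..1})"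
    "Holder_on \<alpha> {0..1} D"
proof -
  obtain M where "\<And>i j. \<bar>translation A i j\<bar> \<le> M * (block_size i j)\<^sup>2"
    using translation_bound by blast
  then obtain K where "tame_shift \<alpha> c w G pos (A $$ (1,0)) (A $$ (3,2)) (translation A) K"
    by (rule tame_shift_exists)
  then interpret tame_shift \<alpha> c w G pos "A $$ (1,0)" "A $$ (3,2)" "translation A" K .
  show thesis using that induced_has_derivative Holder_slope unfolding act_def by blast
qed

lemma C1_on_induced_act: "C1_on {0..1} (induced (act A))"
proof -
  obtain D where "\<And>x. x \<in> {0..1} \<Longrightarrow> (induced (act A) has_real_derivative D x) (at x within {0..1})"
    "Holder_on \<alpha> {0..1} D" using act_derivative by blast
  then show ?thesis unfolding C1_on_def using Holder_on_imp_continuous_on \<alpha>(1) by blast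
qed

section \<open>The embedding of the matrix group\<close>

lemma lex_mono_act: "lex_mono (act A)"
  unfolding act_def by (rule lex_mono_shift)

text \<open>Restricted to the interval because the elements of \<open>Bij\<close> are
  extensional.\<close>

definition diffeo :: "int mat \<Rightarrow> real \<Rightarrow> real" where
  "diffeo A = (\<lambda>x\<in>{0..1}. induced (act A) x)"

lemma diffeo_mult:
  assumes "A \<in> lower_unitriangular_mats 4" "B \<in> lower_unitriangular_mats 4"
  shows "diffeo (A * B) = compose {0..1} (diffeo A) (diffeo B)"
proof -
  let ?U = "unitriangular_group 4"
  interpret group ?U by (rule group_unitriangular_group)
  \<comment> \<open>The inverse matrix supplies the monotone inverse of the composite that
    \<open>induced_compose\<close> requires.\<close>
  define C where "C = inv\<^bsub>?U\<^esub> (A * B)"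
  have AB: "A * B \<in> carrier ?U" using unitriangular_mult[OF assms] by (simp add: unitriangular_group_def)
  then have C: "C \<in> lower_unitriangular_mats 4"
    unfolding C_def using inv_closed by (simp add: unitriangular_group_def)
  have AB': "A * B \<in> lower_unitriangular_mats 4" by (rule unitriangular_mult[OF assms])
  have "C * (A * B) = 1\<^sub>m 4" "A * B * C = 1\<^sub>m 4"
    using l_inv[OF AB] r_inv[OF AB] by (simp_all add: C_def unitriangular_group_def)
  then have "act C (act A (act B y)) = y" "act A (act B (act C y)) = y" for y
    using act_mult[OF C AB', of y] act_mult[OF AB' C, of y] act_mult[OF assms] act_one by simp_all
  moreover have "act (A * B) = (\<lambda>y. act A (act B y))" using act_mult[OF assms] by (rule ext)
  ultimately have "induced (act A) (induced (act B) x) = induced (act (A * B)) x" if "x \<in> {0..1}" for x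
    using induced_compose[OF lex_mono_act lex_mono_act lex_mono_act, of C A B] that by metis
  then show ?thesis
    using induced_bounds by (auto simp: diffeo_def compose_def)
qed

text \<open>On the interval the inverse of \<open>diffeo A\<close> is induced by the inverse matrix
  \<open>B\<close>, so its regularity is another instance of
  \<open>C1_on_induced_act\<close>.\<close>

lemma diffeo_in_diffeos:
  assumes A: "A \<in> lower_unitriangular_mats 4"
  shows "diffeo A \<in> diffeos \<alpha>"
proof -
  let ?U = "unitriangular_group 4"
  interpret group ?U by (rule group_unitriangular_group)
  define B where "B = inv\<^bsub>?U\<^esub> A"
  have A': "A \<in> carrier ?U" using A by (simp add: unitriangular_group_def)
  then have B: "B \<in> lower_unitriangular_mats 4"
    unfolding B_def using inv_closed by (simp add: unitriangular_group_def)
  have "B * A = 1\<^sub>m 4" "A * B = 1\<^sub>m 4"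
    using l_inv[OF A'] r_inv[OF A'] by (simp_all add: B_def unitriangular_group_def)
  then have inv: "act B (act A y) = y" "act A (act B y) = y" for y
    using act_mult[OF B A, of y] act_mult[OF A B, of y] act_one by simp_all
  note bij = bij_betw_induced[OF lex_mono_act lex_mono_act inv]
  have bij': "bij_betw (diffeo A) {0..1} {0..1}"
    using bij by (subst bij_betw_cong[of _ _ "induced (act A)"]) (simp_all add: diffeo_def)
  then have "diffeo A \<in> Bij {0..1}" by (simp add: Bij_def diffeo_def)
  moreover have "strict_mono_on {0..1} (diffeo A)"
    using strict_mono_on_induced[OF lex_mono_act lex_mono_act inv]
    by (simp add: diffeo_def strict_mono_on_def)
  moreover have "C1_on {0..1} (diffeo A)"
    by (rule C1_on_cong[OF C1_on_induced_act]) (simp add: diffeo_def)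
  moreover have "C1_on {0..1} (inv_into {0..1} (diffeo A))"
  proof (rule C1_on_cong[OF C1_on_induced_act])
    fix x :: real assume x: "x \<in> {0..1}"
    show "inv_into {0..1} (diffeo A) x = induced (act B) x"
    proof (rule inv_into_f_eq)
      show "inj_on (diffeo A) {0..1}" using bij' by (simp add: bij_betw_def)
      show "induced (act B) x \<in> {0..1}" using induced_bounds by simp
      then show "diffeo A (induced (act B) x) = x"
        using induced_inverse[OF lex_mono_act lex_mono_act inv(2) x] by (simp add: diffeo_def)
    qed
  qed
  moreover have "Holder_deriv_on \<alpha> {0..1} (diffeo A)"
  proof -
    obtain D where D: "\<And>x. x \<in> {0..1} \<Longrightarrow> (induced (act A) has_real_derivative D x) (at x within {0..1})"
      "Holder_on \<alpha> {0..1} D" using act_derivative by blast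
    have "(diffeo A has_real_derivative D x) (at x within {0..1})" if "x \<in> {0..1}" for x
      by (rule has_real_derivative_transform_on[OF that _ D(1)[OF that]]) (simp add: diffeo_def)
    then show ?thesis unfolding Holder_deriv_on_def using D(2) by blast
  qed
  ultimately show ?thesis by (simp add: diffeos_def)
qed

text \<open>The values at the points \<open>pt y\<close> recover the action, which is faithful by
  \<open>act_inject\<close>.\<close>

lemma inj_on_diffeo: "inj_on diffeo (lower_unitriangular_mats 4)"
proof (rule inj_onI)
  fix A B assume AB: "A \<in> lower_unitriangular_mats 4" "B \<in> lower_unitriangular_mats 4"
    and eq: "diffeo A = diffeo B"
  have "act A y = act B y" for y
  proof -
    have "pt y \<in> {0..1}" using pt_bounds[of y] by simp
    then have "induced (act A) (pt y) = induced (act B) (pt y)"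
      using fun_cong[OF eq, of "pt y"] by (simp add: diffeo_def)
    then show ?thesis by (simp add: induced_pt lex_mono_act)
  qed
  then show "A = B" by (rule act_inject[OF AB])
qed

lemma diffeo_hom: "diffeo \<in> hom (unitriangular_group 4) (Diff_group \<alpha>)"
proof (rule homI)
  fix A B assume "A \<in> carrier (unitriangular_group 4)" "B \<in> carrier (unitriangular_group 4)"
  then have AB: "A \<in> lower_unitriangular_mats 4" "B \<in> lower_unitriangular_mats 4"
    by (simp_all add: unitriangular_group_def)
  show "diffeo A \<in> carrier (Diff_group \<alpha>)"
    using diffeo_in_diffeos[OF AB(1)] by (simp add: Diff_group_def)
  have "diffeo A \<in> Bij {0..1}" "diffeo B \<in> Bij {0..1}"
    using diffeo_in_diffeos AB by (simp_all add: diffeos_def)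
  then show "diffeo (A \<otimes>\<^bsub>unitriangular_group 4\<^esub> B) = diffeo A \<otimes>\<^bsub>Diff_group \<alpha>\<^esub> diffeo B"
    using diffeo_mult[OF AB] by (simp add: Diff_group_def BijGroup_def unitriangular_group_def)
qed

end

theorem theoremA:
  fixes \<alpha> :: real
  assumes "0 < \<alpha>" and "\<alpha> < 1 / 2"
  shows "\<exists>h \<in> hom (unitriangular_group 4) (Diff_group \<alpha>).
           inj_on h (carrier (unitriangular_group 4))"
proof -
  obtain c G where G: "c > 0"
    "\<And>s. (G has_real_derivative c * (1 + s\<^sup>2) powr (-3/4)) (at s)"
    "(G \<longlongrightarrow> 0) at_bot" "(G \<longlongrightarrow> 1) at_top"
    using profile_exists by blast
  \<comment> \<open>The summability of the cell lengths over all pairs of integers rests on this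
    inequality.\<close>
  have "1 / \<alpha> > 2" using assms by (simp add: field_simps)
  then obtain w pos where pos: "w > 0"
    "\<And>i j i' j'. i < i' \<or> i = i' \<and> j < j' \<Longrightarrow> pos i j + w * block_size i j powr -(1/\<alpha>) \<le> pos i' j'"
    "\<And>i j. 0 \<le> pos i j" "\<And>i j. pos i j + w * block_size i j powr -(1/\<alpha>) \<le> 1"
    "countable ({0..1} - (\<Union>i j. {pos i j<..<pos i j + w * block_size i j powr -(1/\<alpha>)}))"
    by (rule tiling_exists) blast
  interpret tiling \<alpha> c w G pos
    by unfold_locales (rule assms G pos, assumption?)+
  show ?thesis
    using diffeo_hom inj_on_diffeo by (auto simp: unitriangular_group_def)
qed

end
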